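(* Let $(R,B)$ be a fusion ring with a fixed-point-free automorphism $\phi\in\mathrm{Aut}(R,B)$ of prime order such that $B$ has exactly two $\phi$-orbits (one of which is $\{1_R\}$). Then $R\cong\mathbb{Z}G$ as fusion rings, where either $G\cong C_3$, or $G\cong C_2^n$ for some $n\in\mathbb{Z}_{\geq2}$ such that $2^n-1$ is prime. In particular, for any odd prime $p\in\mathbb{Z}_{\geq3}$ such that $p+1$ is not a power of $2$, there does not exist a fusion ring of rank $p+1$ with a fixed-point-free automorphism of any prime order.
   Context: A fusion ring $(R,B)$ is an associative unital ring $R$, free as a $\mathbb{Z}$-module with a distinguished finite basis $B=\{b_0=1_R,b_1,\ldots,b_n\}$, together with an anti-involution (duality) $b_i\mapsto b_i^\ast=b_{i^\ast}$ of $B$, extended linearly to an antiautomorphism of $R$, such that $b_ib_j=\sum_k c_{ij}^k b_k$ with $c_{ij}^k\in\mathbb{Z}_{\geq0}$ and $c_{ij}^0=\delta_{i,j^\ast}$. The rank of $R$ is $|B|$. An isomorphism of fusion rings is a unital ring isomorphism carrying the distinguished basis onto the distinguished basis. $\mathrm{Aut}(R,B)$ is the group of permutations of $B$ whose linear extension to $R$ is a unital ring automorphism. $\phi\in\mathrm{Aut}(R,B)$ is fixed-point-free if $1_R$ is the only element of $B$ fixed by $\phi$. A $\phi$-orbit is an orbit of the cyclic group generated by $\phi$ acting on $B$. For a finite group $G$, the integral group ring $\mathbb{Z}G$ is a fusion ring with basis $G$ and $g^\ast=g^{-1}$. $C_m$ denotes the cyclic group of order $m$. *)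

theory Defs
  imports
    "HOL-Computational_Algebra.Primes"
    "HOL-Algebra.Bij"
    "HOL-Algebra.Group_Action"
    "HOL-Algebra.Multiplicative_Group"
    "HOL-Algebra.Product_Groups"
    "HOL-Algebra.QuotRing"
begin

definition basis_coord :: "('a, 'm) ring_scheme \<Rightarrow> 'a set \<Rightarrow> 'a \<Rightarrow> 'a \<Rightarrow> int" where
  "basis_coord R B x =
     (THE c. c \<in> B \<rightarrow>\<^sub>E UNIV \<and> x = (\<Oplus>\<^bsub>R\<^esub>b\<in>B. [c b] \<cdot>\<^bsub>R\<^esub> b))"

definition lin_ext :: "('a, 'm) ring_scheme \<Rightarrow> 'a set \<Rightarrow> ('a \<Rightarrow> 'a) \<Rightarrow> 'a \<Rightarrow> 'a" where
  "lin_ext R B f x = (\<Oplus>\<^bsub>R\<^esub>b\<in>B. [basis_coord R B x b] \<cdot>\<^bsub>R\<^esub> f b)"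

definition opposite_ring :: "('a, 'm) ring_scheme \<Rightarrow> ('a, 'm) ring_scheme" where
  "opposite_ring R = R\<lparr>monoid.mult := \<lambda>x y. y \<otimes>\<^bsub>R\<^esub> x\<rparr>"

locale fusion_ring = ring R for R (structure) +
  fixes B :: "'a set" and star :: "'a \<Rightarrow> 'a"
  assumes finite_basis: "finite B"
    and basis_closed: "B \<subseteq> carrier R"
    and one_in_basis: "\<one> \<in> B"
    and free_basis: "x \<in> carrier R \<Longrightarrow>
      \<exists>!c. c \<in> B \<rightarrow>\<^sub>E (UNIV :: int set) \<and> x = (\<Oplus>b\<in>B. [c b] \<cdot> b)"
    and star_closed: "b \<in> B \<Longrightarrow> star b \<in> B"
    and star_star: "b \<in> B \<Longrightarrow> star (star b) = b"
    and star_antiauto: "lin_ext R B star \<in> ring_iso R (opposite_ring R)"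
    and structure_consts_nonneg:
      "\<lbrakk>a \<in> B; b \<in> B; c \<in> B\<rbrakk> \<Longrightarrow> 0 \<le> basis_coord R B (a \<otimes> b) c"
    and structure_consts_one:
      "\<lbrakk>a \<in> B; b \<in> B\<rbrakk> \<Longrightarrow> basis_coord R B (a \<otimes> b) \<one> = (if a = star b then 1 else 0)"

text \<open>Isomorphisms are not required to respect the dualities: the structure constants
  determine the duality, so this is automatic.\<close>

definition fusion_ring_iso ::
    "('a, 'm) ring_scheme \<Rightarrow> 'a set \<Rightarrow> ('b, 'n) ring_scheme \<Rightarrow> 'b set \<Rightarrow> bool" where
  "fusion_ring_iso R B S C \<longleftrightarrow> (\<exists>h \<in> ring_iso R S. h ` B = C)"

definition fusion_Aut :: "('a, 'm) ring_scheme \<Rightarrow> 'a set \<Rightarrow> ('a \<Rightarrow> 'a) monoid" where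
  "fusion_Aut R B = (BijGroup B)\<lparr>carrier := {\<phi> \<in> Bij B. lin_ext R B \<phi> \<in> ring_iso R R}\<rparr>"

definition fixed_point_free :: "('a, 'm) ring_scheme \<Rightarrow> 'a set \<Rightarrow> ('a \<Rightarrow> 'a) \<Rightarrow> bool" where
  "fixed_point_free R B \<phi> \<longleftrightarrow> {b \<in> B. \<phi> b = b} = {\<one>\<^bsub>R\<^esub>}"

definition aut_orbits :: "('a, 'm) ring_scheme \<Rightarrow> 'a set \<Rightarrow> ('a \<Rightarrow> 'a) \<Rightarrow> 'a set set" where
  "aut_orbits R B \<phi> = orbits (subgroup_generated (fusion_Aut R B) {\<phi>}) B (\<lambda>\<psi>. \<psi>)"

text \<open>The integral group ring of a finite group: functions from the group to the integers
  (extended by zero outside the carrier) under convolution. Its basis consists of the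
  indicator functions of the group elements.\<close>

definition group_ring :: "('g, 'm) monoid_scheme \<Rightarrow> ('g \<Rightarrow> int) ring" where
  "group_ring G =
     \<lparr>carrier = {f. \<forall>x. x \<notin> carrier G \<longrightarrow> f x = 0},
      monoid.mult = (\<lambda>f h x. \<Sum>(y, z) \<in> {(y, z). y \<in> carrier G \<and> z \<in> carrier G \<and> y \<otimes>\<^bsub>G\<^esub> z = x}.
                        f y * h z),
      monoid.one = (\<lambda>x. if x = \<one>\<^bsub>G\<^esub> then 1 else 0),
      ring.zero = (\<lambda>x. 0),
      ring.add = (\<lambda>f h x. f x + h x)\<rparr>"

definition group_ring_elt :: "'g \<Rightarrow> 'g \<Rightarrow> int" where
  "group_ring_elt g = (\<lambda>x. if x = g then 1 else 0)"

definition group_ring_basis :: "('g, 'm) monoid_scheme \<Rightarrow> ('g \<Rightarrow> int) set" where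
  "group_ring_basis G = group_ring_elt ` carrier G"

definition group_ring_star :: "('g, 'm) monoid_scheme \<Rightarrow> ('g \<Rightarrow> int) \<Rightarrow> 'g \<Rightarrow> int" where
  "group_ring_star G f = (\<lambda>x. if x \<in> carrier G then f (inv\<^bsub>G\<^esub> x) else 0)"

abbreviation group_power :: "('g, 'm) monoid_scheme \<Rightarrow> nat \<Rightarrow> (nat \<Rightarrow> 'g) monoid" where
  "group_power G n \<equiv> product_group {..<n} (\<lambda>_. G)"

context fusion_ring begin

lemma coord: assumes "x \<in> carrier R"
  shows "basis_coord R B x \<in> B \<rightarrow>\<^sub>E UNIV" "x = (\<Oplus>b\<in>B. [basis_coord R B x b] \<cdot> b)"
  using theI'[OF free_basis[OF assms]] unfolding basis_coord_def by auto

lemma coord_eq: assumes "x \<in> carrier R" "x = (\<Oplus>b\<in>B. [c b] \<cdot> b)" "b \<in> B"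
  shows "basis_coord R B x b = c b"
proof -
  have "(\<Oplus>b\<in>B. [c b] \<cdot> b) = (\<Oplus>b\<in>B. [restrict c B b] \<cdot> b)"
    using basis_closed by (intro finsum_cong') (auto intro!: add.int_pow_closed)
  then have "x = (\<Oplus>b\<in>B. [restrict c B b] \<cdot> b)" using assms(2) by (rule trans[rotated])
  then have "basis_coord R B x = restrict c B"
    unfolding basis_coord_def by (intro the1_equality[OF free_basis[OF assms(1)]] conjI restrict_PiE_iff[THEN iffD2]) auto
  then show ?thesis using assms(3) by simp
qed

lemma hom_eq_lin_ext:
  assumes h: "h \<in> ring_hom R R" and f: "\<And>b. b \<in> B \<Longrightarrow> h b = f b" and x: "x \<in> carrier R"
  shows "h x = lin_ext R B f x"
proof -
  interpret h: ring_hom_ring R R h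
    by (rule ring_hom_ringI2) (use h in \<open>auto intro: ring_axioms\<close>)
  have zp: "h ([k] \<cdot> b) = [k] \<cdot> h b" if "b \<in> carrier R" for k :: int and b
  proof -
    interpret A: group_hom "add_monoid R" "add_monoid R" h
      by (rule h.a_group_hom)
    show ?thesis using A.hom_int_pow[of b k] that by (simp add: add_pow_def)
  qed
  have "h x = h (\<Oplus>b\<in>B. [basis_coord R B x b] \<cdot> b)" using coord[OF x] by simp
  also have "\<dots> = (\<Oplus>b\<in>B. h ([basis_coord R B x b] \<cdot> b))"
    using basis_closed by (subst h.hom_finsum) (auto simp: o_def)
  also have "\<dots> = lin_ext R B f x"
    unfolding lin_ext_def using basis_closed
    by (intro finsum_cong') (auto simp: zp f[symmetric] subset_iff)
  finally show ?thesis .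
qed

lemma lin_ext_basis:
  assumes f: "f \<in> B \<rightarrow> carrier R" and b: "b \<in> B"
  shows "lin_ext R B f b = f b"
proof -
  have bc: "b \<in> carrier R" using b basis_closed by auto
  have p1: "[(1 :: int)] \<cdot> x = x" if "x \<in> carrier R" for x
    using add.int_pow_1[OF that] by simp
  have p0: "[(0 :: int)] \<cdot> x = \<zero>" for x by (simp add: add_pow_def)
  have "b = (\<Oplus>a\<in>B. if b = a then a else \<zero>)"
    using finsum_singleton[OF b finite_basis, of "\<lambda>a. a"] basis_closed by (auto simp: Pi_def subset_iff)
  also have "\<dots> = (\<Oplus>a\<in>B. [(if a = b then 1 else 0 :: int)] \<cdot> a)"
    using basis_closed p1 p0 by (intro finsum_cong') auto
  finally have e: "b = (\<Oplus>a\<in>B. [(if a = b then 1 else 0 :: int)] \<cdot> a)" .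
  have c: "basis_coord R B b a = (if a = b then 1 else 0)" if "a \<in> B" for a
    by (rule coord_eq[OF bc e that])
  have "lin_ext R B f b = (\<Oplus>a\<in>B. if b = a then f a else \<zero>)"
    unfolding lin_ext_def using f 
    by (intro finsum_cong') (auto simp: c p0 Pi_def intro!: p1)
  also have "\<dots> = f b" using finsum_singleton[OF b finite_basis f] by simp
  finally show ?thesis .
qed

lemma Bij_closed: "f \<in> Bij B \<Longrightarrow> f \<in> B \<rightarrow> carrier R"
  using Bij_imp_funcset basis_closed by fastforce

lemma ring_iso_cong: 
  assumes "h \<in> ring_iso R R" "\<And>x. x \<in> carrier R \<Longrightarrow> h x = g x"
  shows "g \<in> ring_iso R R"
proof -
  have "bij_betw g (carrier R) (carrier R)" using assms bij_betw_cong[of "carrier R" h g] by (auto simp: ring_iso_def)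
  moreover have "h \<in> ring_hom R R" using assms(1) by (simp add: ring_iso_def)
  then have "g \<in> ring_hom R R"
    using ring_hom_memE[of h R R] assms(2)
    by (intro ring_hom_memI) (metis a_closed m_closed one_closed)+
  ultimately show ?thesis by (simp add: ring_iso_def)
qed

lemma group_fusion_Aut: "group (fusion_Aut R B)"
proof -
  let ?A = "{\<phi> \<in> Bij B. lin_ext R B \<phi> \<in> ring_iso R R}"
  have iso_hom: "h \<in> ring_iso R R \<Longrightarrow> h \<in> ring_hom R R" for h by (simp add: ring_iso_def)
  interpret G: group "BijGroup B" by (rule group_BijGroup)
  have "subgroup ?A (BijGroup B)"
  proof (rule G.subgroupI)
    show "?A \<subseteq> carrier (BijGroup B)" by (auto simp: BijGroup_def)
    have "(\<lambda>x\<in>B. x) \<in> ?A"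
      using ring_iso_cong[OF ring_iso_set_refl, of "lin_ext R B (\<lambda>x\<in>B. x)"]
        hom_eq_lin_ext[OF iso_hom[OF ring_iso_set_refl], of "\<lambda>x\<in>B. x"] id_Bij by auto
    then show "?A \<noteq> {}" by blast
  next
    fix a assume a: "a \<in> ?A"
    then have aB: "a \<in> Bij B" and ai: "lin_ext R B a \<in> ring_iso R R" by auto
    let ?h = "inv_into (carrier R) (lin_ext R B a)"
    have hi: "?h \<in> ring_iso R R" by (rule ring_iso_set_sym[OF ring_axioms ai]) 
    have v: "inv\<^bsub>BijGroup B\<^esub> a = (\<lambda>x\<in>B. inv_into B a x)" by (rule inv_BijGroup[OF aB])
    have inj: "inj_on (lin_ext R B a) (carrier R)" using ai by (auto simp: ring_iso_def bij_betw_def)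
    have "?h b = (\<lambda>x\<in>B. inv_into B a x) b" if "b \<in> B" for b
    proof -
      have m: "inv_into B a b \<in> B" using Bij_inv_into_mem[OF aB that] .
      have "lin_ext R B a (inv_into B a b) = b"
        using lin_ext_basis[OF Bij_closed[OF aB] m] that aB
        by (auto simp: Bij_def bij_betw_def f_inv_into_f)
      then have "?h b = inv_into B a b"
        using inv_into_f_f[OF inj] m basis_closed by (metis subsetD)
      then show ?thesis using that by simp
    qed
    from hom_eq_lin_ext[OF iso_hom[OF hi] this]
    have "lin_ext R B (\<lambda>x\<in>B. inv_into B a x) \<in> ring_iso R R" using ring_iso_cong[OF hi] by blast
    then show "inv\<^bsub>BijGroup B\<^esub> a \<in> ?A" using restrict_inv_into_Bij[OF aB] v by simp
  next
    fix a c assume a: "a \<in> ?A" and c: "c \<in> ?A"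
    then have ac: "a \<in> Bij B" "c \<in> Bij B" by auto
    let ?h = "lin_ext R B a \<circ> lin_ext R B c"
    have hi: "?h \<in> ring_iso R R" using a c ring_iso_set_trans by blast
    have "?h b = compose B a c b" if "b \<in> B" for b
      using that lin_ext_basis[OF Bij_closed[OF ac(1)]] lin_ext_basis[OF Bij_closed[OF ac(2)]]
        Bij_imp_funcset[OF ac(2)] by (auto simp: compose_def Pi_def)
    from hom_eq_lin_ext[OF iso_hom[OF hi] this]
    have "lin_ext R B (compose B a c) \<in> ring_iso R R" using ring_iso_cong[OF hi] by blast
    then show "a \<otimes>\<^bsub>BijGroup B\<^esub> c \<in> ?A" using ac compose_Bij by (auto simp: BijGroup_def)
  qed
  then show ?thesis unfolding fusion_Aut_def using G.subgroup_imp_group by auto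
qed

end

lemma group_ring_mult:
  assumes "finite (carrier G)"
  shows "(f \<otimes>\<^bsub>group_ring G\<^esub> h) x =
    (\<Sum>y\<in>carrier G. \<Sum>z\<in>carrier G. if y \<otimes>\<^bsub>G\<^esub> z = x then f y * h z else 0)"
proof -
  have "{(y, z). y \<in> carrier G \<and> z \<in> carrier G \<and> y \<otimes>\<^bsub>G\<^esub> z = x}
      = {p \<in> carrier G \<times> carrier G. fst p \<otimes>\<^bsub>G\<^esub> snd p = x}" by auto
  then show ?thesis using assms
    by (auto simp: group_ring_def sum.cartesian_product sum.inter_filter case_prod_unfold)
qed

lemma ring_group_ring:
  fixes G (structure)
  assumes "group G" "finite (carrier G)"
  shows "ring (group_ring G)"
proof -
  interpret group G by fact
  note fin = assms(2)
  let ?R = "group_ring G"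
  have car: "carrier ?R = {f. \<forall>x. x \<notin> carrier G \<longrightarrow> f x = 0}" by (simp add: group_ring_def)
  have add: "f \<oplus>\<^bsub>?R\<^esub> h = (\<lambda>x. f x + h x)" for f h by (simp add: group_ring_def)
  have zero: "\<zero>\<^bsub>?R\<^esub> = (\<lambda>x. 0)" by (simp add: group_ring_def)
  have one: "\<one>\<^bsub>?R\<^esub> = (\<lambda>x. if x = \<one> then 1 else 0)" by (simp add: group_ring_def)
  note M = group_ring_mult[OF fin]
  have closed: "f \<otimes>\<^bsub>?R\<^esub> h \<in> carrier ?R" for f h
    by (auto simp: car M intro!: sum.neutral)
  show ?thesis
  proof (rule ringI)
    show "abelian_group ?R"
    proof (rule abelian_groupI)
      fix f assume "f \<in> carrier ?R"
      then show "\<exists>y\<in>carrier ?R. y \<oplus>\<^bsub>?R\<^esub> f = \<zero>\<^bsub>?R\<^esub>"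
        by (intro bexI[of _ "\<lambda>x. - f x"]) (auto simp: car add zero)
    qed (auto simp: car add zero)
    show "monoid ?R"
    proof (rule monoidI)
      fix f g h assume f: "f \<in> carrier ?R" and g: "g \<in> carrier ?R" and h: "h \<in> carrier ?R"
      show "f \<otimes>\<^bsub>?R\<^esub> g \<otimes>\<^bsub>?R\<^esub> h = f \<otimes>\<^bsub>?R\<^esub> (g \<otimes>\<^bsub>?R\<^esub> h)"
      proof
        fix x
        let ?C = "carrier G"
        have "(f \<otimes>\<^bsub>?R\<^esub> g \<otimes>\<^bsub>?R\<^esub> h) x = (\<Sum>y\<in>?C. \<Sum>c\<in>?C. \<Sum>a\<in>?C. \<Sum>b\<in>?C.
            if a \<otimes> b = y then (if y \<otimes> c = x then f a * g b * h c else 0) else 0)"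
          unfolding M 
          by (intro sum.cong refl) (simp add: sum_distrib_right if_distrib[of "\<lambda>u. u * _"] cong: if_cong) 
        also have "\<dots> = (\<Sum>c\<in>?C. \<Sum>a\<in>?C. \<Sum>b\<in>?C. \<Sum>y\<in>?C.
            if a \<otimes> b = y then (if y \<otimes> c = x then f a * g b * h c else 0) else 0)"
          by (rule trans[OF sum.swap], rule sum.cong[OF refl], rule trans[OF sum.swap],
              rule sum.cong[OF refl], rule sum.swap)
        also have "\<dots> = (\<Sum>c\<in>?C. \<Sum>a\<in>?C. \<Sum>b\<in>?C.
            if (a \<otimes> b) \<otimes> c = x then f a * g b * h c else 0)"
          using fin by (intro sum.cong refl) (simp add: sum.delta')
        also have "\<dots> = (\<Sum>a\<in>?C. \<Sum>b\<in>?C. \<Sum>c\<in>?C.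
            if a \<otimes> (b \<otimes> c) = x then f a * g b * h c else 0)"
          by (rule trans[OF sum.swap], rule sum.cong[OF refl], rule trans[OF sum.swap])
             (intro sum.cong refl, simp add: m_assoc)
        also have "\<dots> = (\<Sum>a\<in>?C. \<Sum>b\<in>?C. \<Sum>c\<in>?C. \<Sum>y\<in>?C.
            if b \<otimes> c = y then (if a \<otimes> y = x then f a * (g b * h c) else 0) else 0)"
          using fin by (intro sum.cong refl) (simp add: sum.delta' mult.assoc)
        also have "\<dots> = (\<Sum>a\<in>?C. \<Sum>y\<in>?C. \<Sum>b\<in>?C. \<Sum>c\<in>?C.
            if b \<otimes> c = y then (if a \<otimes> y = x then f a * (g b * h c) else 0) else 0)"
          by (rule sum.cong[OF refl], rule sym, rule trans[OF sum.swap],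
              rule sum.cong[OF refl], rule sum.swap)
        also have "\<dots> = (f \<otimes>\<^bsub>?R\<^esub> (g \<otimes>\<^bsub>?R\<^esub> h)) x"
          unfolding M 
          by (intro sum.cong refl) (simp add: sum_distrib_left if_distrib[of "\<lambda>u. _ * u"] cong: if_cong)
        finally show "(f \<otimes>\<^bsub>?R\<^esub> g \<otimes>\<^bsub>?R\<^esub> h) x = (f \<otimes>\<^bsub>?R\<^esub> (g \<otimes>\<^bsub>?R\<^esub> h)) x" .
      qed
    next
      fix f assume f: "f \<in> carrier ?R"
      show "\<one>\<^bsub>?R\<^esub> \<otimes>\<^bsub>?R\<^esub> f = f"
      proof
        fix x
        have "(\<one>\<^bsub>?R\<^esub> \<otimes>\<^bsub>?R\<^esub> f) x = (\<Sum>y\<in>carrier G. if y = \<one> then (\<Sum>z\<in>carrier G. if z = x then f z else 0) else 0)"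
          unfolding M one by (auto intro!: sum.cong simp: sum.neutral)
        also have "\<dots> = f x" using fin f by (auto simp: car)
        finally show "(\<one>\<^bsub>?R\<^esub> \<otimes>\<^bsub>?R\<^esub> f) x = f x" .
      qed
      show "f \<otimes>\<^bsub>?R\<^esub> \<one>\<^bsub>?R\<^esub> = f"
      proof
        fix x
        have "(f \<otimes>\<^bsub>?R\<^esub> \<one>\<^bsub>?R\<^esub>) x = (\<Sum>y\<in>carrier G. \<Sum>z\<in>carrier G. if z = \<one> then (if y = x then f y else 0) else 0)"
          unfolding M one by (auto intro!: sum.cong simp: sum.neutral)
        also have "\<dots> = f x" using fin f by (auto simp: car)
        finally show "(f \<otimes>\<^bsub>?R\<^esub> \<one>\<^bsub>?R\<^esub>) x = f x" .
      qed
    qed (auto simp: closed, auto simp: car one)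
  next
    fix f g h
    show "(f \<oplus>\<^bsub>?R\<^esub> g) \<otimes>\<^bsub>?R\<^esub> h = f \<otimes>\<^bsub>?R\<^esub> h \<oplus>\<^bsub>?R\<^esub> g \<otimes>\<^bsub>?R\<^esub> h"
      unfolding add M[THEN ext] sum.distrib[symmetric]
      by (intro ext sum.cong refl) (simp add: algebra_simps)
    show "h \<otimes>\<^bsub>?R\<^esub> (f \<oplus>\<^bsub>?R\<^esub> g) = h \<otimes>\<^bsub>?R\<^esub> f \<oplus>\<^bsub>?R\<^esub> h \<otimes>\<^bsub>?R\<^esub> g"
      unfolding add M[THEN ext] sum.distrib[symmetric]
      by (intro ext sum.cong refl) (simp add: algebra_simps)
  qed
qed

lemma fusion_ring_group_ring:
  fixes G (structure)
  assumes "group G" "finite (carrier G)"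
  shows "fusion_ring (group_ring G) (group_ring_basis G) (group_ring_star G)"
proof -
  interpret group G by fact
  note fin = assms(2)
  let ?R = "group_ring G" let ?B = "group_ring_basis G" let ?e = group_ring_elt
  define st where "st = group_ring_star G"
  interpret R: ring ?R by (rule ring_group_ring) fact+
  have car: "carrier ?R = {f. \<forall>x. x \<notin> carrier G \<longrightarrow> f x = 0}" by (simp add: group_ring_def)
  have add: "f \<oplus>\<^bsub>?R\<^esub> h = (\<lambda>x. f x + h x)" for f h by (simp add: group_ring_def)
  have zero: "\<zero>\<^bsub>?R\<^esub> = (\<lambda>x. 0)" by (simp add: group_ring_def)
  have one: "\<one>\<^bsub>?R\<^esub> = ?e \<one>" by (simp add: group_ring_def group_ring_elt_def)
  note M = group_ring_mult[OF fin]
  have inj: "?e g = ?e h \<longleftrightarrow> g = h" for g h :: 'a by (auto simp: group_ring_elt_def fun_eq_iff)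
  have ec: "g \<in> carrier G \<Longrightarrow> ?e g \<in> carrier ?R" for g by (auto simp: car group_ring_elt_def)
  have s: "st (?e g) = ?e (inv g)" if "g \<in> carrier G" for g
    using that by (auto simp: st_def group_ring_star_def group_ring_elt_def fun_eq_iff)
  have neg: "\<ominus>\<^bsub>?R\<^esub> f = (\<lambda>x. - f x)" if "f \<in> carrier ?R" for f
    by (rule R.minus_equality) (use that in \<open>auto simp: add zero car\<close>)
  have npow: "[n] \<cdot>\<^bsub>?R\<^esub> f = (\<lambda>x. int n * f x)" for n :: nat and f
    by (induct n) (auto simp: add_pow_def nat_pow_def zero add algebra_simps)
  have pow: "[k] \<cdot>\<^bsub>?R\<^esub> f = (\<lambda>x. k * f x)" if "f \<in> carrier ?R" for k :: int and f
  proof (cases "k \<ge> 0")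
    case True then show ?thesis by (simp add: add_pow_int_ge npow)
  next
    case False 
    have "[nat (-k)] \<cdot>\<^bsub>?R\<^esub> f \<in> carrier ?R" using that unfolding npow by (auto simp: car)
    with False show ?thesis by (simp add: add_pow_int_lt neg npow)
  qed
  have fs: "finite A \<Longrightarrow> F \<in> A \<rightarrow> carrier ?R \<Longrightarrow> finsum ?R F A = (\<lambda>x. \<Sum>a\<in>A. F a x)" for F and A :: "'c set"
    by (induct A rule: finite_induct) (auto simp: zero add Pi_def)
  have Bc: "?B \<subseteq> carrier ?R" by (auto simp: group_ring_basis_def ec)
  have Bf: "finite ?B" using fin by (simp add: group_ring_basis_def)
  have comb: "(\<Oplus>\<^bsub>?R\<^esub>b\<in>?B. [c b] \<cdot>\<^bsub>?R\<^esub> F b) = (\<lambda>x. \<Sum>g\<in>carrier G. c (?e g) * F (?e g) x)"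
    if "F \<in> ?B \<rightarrow> carrier ?R" for c :: "_ \<Rightarrow> int" and F
  proof -
    have "(\<Oplus>\<^bsub>?R\<^esub>b\<in>?B. [c b] \<cdot>\<^bsub>?R\<^esub> F b) = (\<lambda>x. \<Sum>b\<in>?B. ([c b] \<cdot>\<^bsub>?R\<^esub> F b) x)"
      using that Bf by (intro fs) (auto intro!: R.add.int_pow_closed)
    also have "\<dots> = (\<lambda>x. \<Sum>b\<in>?B. c b * F b x)"
      using that by (intro ext sum.cong) (auto simp: pow Pi_def)
    also have "\<dots> = (\<lambda>x. \<Sum>g\<in>carrier G. c (?e g) * F (?e g) x)"
      unfolding group_ring_basis_def by (subst sum.reindex) (auto simp: inj inj_on_def)
    finally show ?thesis .
  qed
  have comb_id: "(\<Oplus>\<^bsub>?R\<^esub>b\<in>?B. [c b] \<cdot>\<^bsub>?R\<^esub> b) = (\<lambda>x. if x \<in> carrier G then c (?e x) else 0)" for c :: "_ \<Rightarrow> int"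
    apply (subst comb) using Bc fin 
    by (auto simp: group_ring_elt_def fun_eq_iff if_distrib[of "(*) _"] cong: if_cong)
  have uniq: "\<exists>!c. c \<in> ?B \<rightarrow>\<^sub>E (UNIV :: int set) \<and> x = (\<Oplus>\<^bsub>?R\<^esub>b\<in>?B. [c b] \<cdot>\<^bsub>?R\<^esub> b)" if x: "x \<in> carrier ?R" for x
  proof (rule ex_ex1I)
    show "\<exists>c. c \<in> ?B \<rightarrow>\<^sub>E (UNIV :: int set) \<and> x = (\<Oplus>\<^bsub>?R\<^esub>b\<in>?B. [c b] \<cdot>\<^bsub>?R\<^esub> b)"
    proof (intro exI conjI)
      let ?c = "\<lambda>b\<in>?B. x (THE g. b = ?e g)"
      show "?c \<in> ?B \<rightarrow>\<^sub>E (UNIV :: int set)" by auto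
      have "?c (?e g) = x g" if "g \<in> carrier G" for g using that by (simp add: group_ring_basis_def inj)
      then show "x = (\<Oplus>\<^bsub>?R\<^esub>b\<in>?B. [?c b] \<cdot>\<^bsub>?R\<^esub> b)"
        unfolding comb_id using x by (auto simp only: car fun_eq_iff mem_Collect_eq split: if_splits)
    qed
  next
    fix c d :: "_ \<Rightarrow> int"
    assume c: "c \<in> ?B \<rightarrow>\<^sub>E (UNIV :: int set) \<and> x = (\<Oplus>\<^bsub>?R\<^esub>b\<in>?B. [c b] \<cdot>\<^bsub>?R\<^esub> b)"
      and d: "d \<in> ?B \<rightarrow>\<^sub>E (UNIV :: int set) \<and> x = (\<Oplus>\<^bsub>?R\<^esub>b\<in>?B. [d b] \<cdot>\<^bsub>?R\<^esub> b)"
    then have "(\<lambda>x. if x \<in> carrier G then c (?e x) else 0) = (\<lambda>x. if x \<in> carrier G then d (?e x) else 0)"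
      by (simp add: comb_id)
    then have "c (?e g) = d (?e g)" if "g \<in> carrier G" for g using that by (metis (no_types))
    then have "c b = d b" if "b \<in> ?B" for b using that by (auto simp: group_ring_basis_def)
    then show "c = d" by (rule PiE_ext[OF conjunct1[OF c] conjunct1[OF d]])
  qed
  have bc: "basis_coord ?R ?B x (?e g) = x g" if x: "x \<in> carrier ?R" and g: "g \<in> carrier G" for x g
  proof -
    have "x = (\<Oplus>\<^bsub>?R\<^esub>b\<in>?B. [basis_coord ?R ?B x b] \<cdot>\<^bsub>?R\<^esub> b)"
      using theI'[OF uniq[OF x]] unfolding basis_coord_def by blast
    then show ?thesis using g unfolding comb_id by (metis (no_types, lifting))
  qed
  have emul: "?e g \<otimes>\<^bsub>?R\<^esub> ?e h = ?e (g \<otimes> h)" if "g \<in> carrier G" "h \<in> carrier G" for g h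
  proof
    fix x
    have "(?e g \<otimes>\<^bsub>?R\<^esub> ?e h) x = (\<Sum>y\<in>carrier G. \<Sum>z\<in>carrier G. if z = h then (if y = g then (if g \<otimes> h = x then 1 else 0) else 0) else 0)"
      unfolding M by (intro sum.cong) (auto simp: group_ring_elt_def)
    also have "\<dots> = ?e (g \<otimes> h) x" using fin that by (auto simp: group_ring_elt_def)
    finally show "(?e g \<otimes>\<^bsub>?R\<^esub> ?e h) x = ?e (g \<otimes> h) x" .
  qed
  have L: "lin_ext ?R ?B st f = (\<lambda>x. if x \<in> carrier G then f (inv x) else 0)" if f: "f \<in> carrier ?R" for f
  proof -
    have "lin_ext ?R ?B st f = (\<lambda>x. \<Sum>g\<in>carrier G. basis_coord ?R ?B f (?e g) * st (?e g) x)"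
      unfolding lin_ext_def
      by (rule comb) (auto simp: group_ring_basis_def s intro!: ec)
    also have "\<dots> = (\<lambda>x. \<Sum>g\<in>carrier G. if x \<in> carrier G \<and> g = inv x then f (inv x) else 0)"
      by (intro ext sum.cong refl, simp only: bc f s, auto simp: group_ring_elt_def)
    also have "\<dots> = (\<lambda>x. if x \<in> carrier G then f (inv x) else 0)" using fin by auto
    finally show ?thesis .
  qed
  have Lc: "lin_ext ?R ?B st f \<in> carrier ?R" if "f \<in> carrier ?R" for f using L[OF that] by (auto simp: car)
  have LL: "lin_ext ?R ?B st (lin_ext ?R ?B st f) = f" if "f \<in> carrier ?R" for f
    using that by (subst L[OF Lc[OF that]], subst L[OF that]) (auto simp: car)
  have bij: "bij_betw (\<lambda>x. inv x) (carrier G) (carrier G)"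
    by (rule bij_betw_byWitness[where f' = "\<lambda>x. inv x"]) auto
  show ?thesis unfolding st_def[symmetric]
  proof (unfold_locales, goal_cases)
    case 1 show ?case by (rule Bf) next
    case 2 show ?case by (rule Bc) next
    case 3 show ?case by (auto simp: one group_ring_basis_def) next
    case (4 x) then show ?case by (rule uniq) next
    case (5 b) then show ?case by (auto simp: group_ring_basis_def s) next
    case (6 b) then show ?case by (auto simp: group_ring_basis_def s) next
    case 7
    have "lin_ext ?R ?B st (f \<otimes>\<^bsub>?R\<^esub> h) = lin_ext ?R ?B st h \<otimes>\<^bsub>?R\<^esub> lin_ext ?R ?B st f"
      if f: "f \<in> carrier ?R" and h: "h \<in> carrier ?R" for f h
    proof
      fix x
      show "lin_ext ?R ?B st (f \<otimes>\<^bsub>?R\<^esub> h) x = (lin_ext ?R ?B st h \<otimes>\<^bsub>?R\<^esub> lin_ext ?R ?B st f) x"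
      proof (cases "x \<in> carrier G")
        case True
        have "lin_ext ?R ?B st (f \<otimes>\<^bsub>?R\<^esub> h) x = (f \<otimes>\<^bsub>?R\<^esub> h) (inv x)" using True f h by (subst L) auto
        also have "\<dots> = (\<Sum>y\<in>carrier G. \<Sum>z\<in>carrier G. if y \<otimes> z = inv x then f y * h z else 0)" by (rule M)
        also have "\<dots> = (\<Sum>z\<in>carrier G. \<Sum>y\<in>carrier G. if y \<otimes> z = inv x then f y * h z else 0)" by (rule sum.swap)
        also have "\<dots> = (\<Sum>z\<in>carrier G. \<Sum>y\<in>carrier G. if inv y \<otimes> inv z = inv x then f (inv y) * h (inv z) else 0)"
          by (simp only: sum.reindex_bij_betw[OF bij, of "\<lambda>y. if y \<otimes> _ = inv x then f y * h _ else 0"]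
               sum.reindex_bij_betw[OF bij, of "\<lambda>z. \<Sum>y\<in>carrier G. if y \<otimes> z = inv x then f y * h z else 0"])
        also have "\<dots> = (\<Sum>z\<in>carrier G. \<Sum>y\<in>carrier G. if z \<otimes> y = x then h (inv z) * f (inv y) else 0)"
        proof (intro sum.cong refl)
          fix y z assume "z \<in> carrier G" "y \<in> carrier G"
          then have "inv y \<otimes> inv z = inv x \<longleftrightarrow> z \<otimes> y = x" using True by (metis inv_mult_group inv_inv m_closed)
          then show "(if inv y \<otimes> inv z = inv x then f (inv y) * h (inv z) else 0) = (if z \<otimes> y = x then h (inv z) * f (inv y) else 0)" by simp
        qed
        also have "\<dots> = (lin_ext ?R ?B st h \<otimes>\<^bsub>?R\<^esub> lin_ext ?R ?B st f) x"
          unfolding M by (intro sum.cong refl) (simp add: L f h)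
        finally show ?thesis .
      next
        case False
        then show ?thesis using L[OF R.m_closed[OF f h]] R.m_closed[OF Lc[OF h] Lc[OF f]] by (auto simp: car)
      qed
    qed
    moreover have "lin_ext ?R ?B st \<one>\<^bsub>?R\<^esub> = \<one>\<^bsub>?R\<^esub>"
      by (subst L, simp) (auto simp: one group_ring_elt_def fun_eq_iff)
    moreover have "lin_ext ?R ?B st (f \<oplus>\<^bsub>?R\<^esub> h) = lin_ext ?R ?B st f \<oplus>\<^bsub>?R\<^esub> lin_ext ?R ?B st h"
      if f: "f \<in> carrier ?R" and h: "h \<in> carrier ?R" for f h
      using f h by (subst (1 2 3) L) (auto simp: add car)
    moreover have "bij_betw (lin_ext ?R ?B st) (carrier ?R) (carrier ?R)"
      by (rule bij_betw_byWitness[where f' = "lin_ext ?R ?B st"]) (use Lc LL in auto)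
    ultimately show ?case using Lc by (auto simp: ring_iso_def ring_hom_def opposite_ring_def)
  next
    case (8 a b c)
    then obtain g h k where k: "g \<in> carrier G" "h \<in> carrier G" "k \<in> carrier G" "a = ?e g" "b = ?e h" "c = ?e k"
      by (auto simp: group_ring_basis_def)
    then have "basis_coord ?R ?B (a \<otimes>\<^bsub>?R\<^esub> b) c = ?e (g \<otimes> h) k" by (simp add: emul bc ec)
    then show ?case by (simp add: group_ring_elt_def)
  next
    case (9 a b)
    then obtain g h where k: "g \<in> carrier G" "h \<in> carrier G" "a = ?e g" "b = ?e h"
      by (auto simp: group_ring_basis_def)
    have *: "\<one> = g \<otimes> h \<longleftrightarrow> g = inv h" using k by (metis inv_equality l_inv)
    from k show ?case
      apply (simp only: s emul one)
      apply (subst bc)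
      by (simp_all add: ec inj) (auto simp: group_ring_elt_def *)
  qed
qed

end

theory Submission
  imports Defs "HOL-Algebra.Sylow"
begin

text \<open>
  Let \<open>\<sigma>\<close> be the sum of the \<open>P\<close> nontrivial basis elements. Since the automorphism group acts
  transitively on them, \<open>\<sigma>\<^sup>2 = P + m \<sigma>\<close> for some \<open>m\<close>, so the nonnegative integer matrix \<open>S\<close> of
  multiplication by \<open>\<sigma>\<close>, restricted to the nontrivial basis elements, satisfies \<open>J + S\<^sup>2 = P I + m S\<close>
  (\<open>J\<close> the all-ones matrix) and has constant column sums \<open>m\<close>. A maximum modulus argument then forces
  \<open>S = (1/k) J - k I\<close> for some \<open>k > 0\<close>; integrality of the entries gives \<open>k = 1\<close>. Hence, by Frobenius
  reciprocity, a product of two basis elements is a basis element, so \<open>B\<close> is a group of order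
  \<open>P + 1\<close> and \<open>R\<close> is its group ring. Here \<open>P\<close> is the prime order of the automorphism. If \<open>P = 2\<close> the
  group is cyclic of order 3; otherwise it contains an involution, by transitivity it
  has exponent 2, and it is elementary abelian.

  In rank \<open>p + 1\<close> every nontrivial orbit has as many elements as the order of the automorphism, so
  that order divides \<open>p\<close>, hence equals \<open>p\<close>, and there are exactly two orbits.
\<close>

section \<open>Nonnegative integer matrices with constant column sums and a quadratic
  relation\<close>

text \<open>The relation determines the matrix over the reals, as \<open>J / k - k I\<close> with
  \<open>J\<close> the all-ones matrix. An off-diagonal and a diagonal entry, both integers, then
  leave only \<open>k = 1\<close>.\<close>

lemma quadratic_constant_colsum_matrix:
  fixes s :: "'b \<Rightarrow> 'b \<Rightarrow> int"
  assumes fin: "finite A" and card: "card A \<ge> 2"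
    and nonneg: "\<And>a b. a \<in> A \<Longrightarrow> b \<in> A \<Longrightarrow> 0 \<le> s a b"
    and colsum: "\<And>b. b \<in> A \<Longrightarrow> (\<Sum>a\<in>A. s a b) = m"
    and quad: "\<And>a c. a \<in> A \<Longrightarrow> c \<in> A \<Longrightarrow>
      1 + (\<Sum>b\<in>A. s a b * s b c) = (if a = c then int (card A) else 0) + m * s a c"
    and a: "a \<in> A" and c: "c \<in> A"
  shows "s a c = (if a = c then 0 else 1)"
proof -
  define P where "P = real (card A)"
  define D where "D = (m + sqrt (m\<^sup>2 + 4 * P)) / 2"
  \<comment> \<open>\<open>D\<close> and \<open>-k\<close> are the roots of \<open>x\<^sup>2 = m x + P\<close>, so \<open>(S - D) (S + k) = -J\<close>; the column sums
    \<open>m < D\<close> make \<open>S - D\<close> invertible.\<close>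
  define k where "k = D - m"
  have P0: "P > 0" using card by (simp add: P_def)
  have m0: "m \<ge> 0" using colsum[OF a, symmetric] nonneg[OF _ a] by (simp add: sum_nonneg)
  have "sqrt (m\<^sup>2 + 4 * P) > sqrt (m\<^sup>2)" using P0 by (subst real_sqrt_less_iff) simp
  then have Dm: "D > m" using m0 by (simp add: D_def)
  then have k0: "k > 0" and D0: "D > 0" using m0 by (simp_all add: k_def)
  have "(sqrt (m\<^sup>2 + 4 * P))\<^sup>2 = m\<^sup>2 + 4 * P" using P0 by simp
  then have Dk: "D * k = P"
    unfolding k_def D_def by (simp add: field_simps power2_eq_square)
  have DE: "D = m + k" by (simp add: k_def)
  have Dk': "D * (1 / k) = 1 + m / k" using k0 by (simp add: DE field_simps)
  have entry: "s a b + (if a = b then k else 0) = 1 / k" if a: "a \<in> A" and b: "b \<in> A" for a b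
  proof -
    \<comment> \<open>\<open>w\<close> is row \<open>a\<close> of \<open>S + k I - J / k\<close>, to
      be shown zero.\<close>
    define w where "w b = s a b + (if a = b then k else 0) - 1 / k" for b
    \<comment> \<open>Constant column sums give \<open>J S = m J\<close>, so
      \<open>(J / k) (S - D) = -J\<close>, which is also \<open>(S + k) (S - D)\<close>. The
      difference of the two left factors is therefore annihilated by \<open>S - D\<close>.\<close>
    have eig: "(\<Sum>b\<in>A. w b * s b c) = D * w c" if c: "c \<in> A" for c
    proof -
      have "(\<Sum>b\<in>A. w b * s b c) = (\<Sum>b\<in>A. s a b * s b c)
          + (\<Sum>b\<in>A. if a = b then k * s b c else 0) - (\<Sum>b\<in>A. s b c / k)"
        unfolding of_int_sum sum.distrib[symmetric] sum_subtractf[symmetric]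
        by (intro sum.cong refl) (simp add: w_def algebra_simps)
      also have "(\<Sum>b\<in>A. if a = b then k * s b c else 0) = k * s a c"
        using fin a by simp
      also have "(\<Sum>b\<in>A. s b c / k) = m / k"
        by (simp add: sum_divide_distrib[symmetric] colsum[OF c] flip: of_int_sum)
      also have "real_of_int (\<Sum>b\<in>A. s a b * s b c) = (if a = c then P else 0) + m * s a c - 1"
        using arg_cong[OF quad[OF a c], of real_of_int] by (simp add: P_def split: if_splits)
      also have "(if a = c then P else 0) + m * s a c - 1 + k * s a c - m / k = D * w c"
        using Dk Dk' by (auto simp: w_def algebra_simps DE)
      finally show ?thesis .
    qed
    \<comment> \<open>At a column \<open>c\<close> where the modulus of \<open>w\<close> is largest,
      the eigenvector equation bounds \<open>D * \<bar>w c\<bar>\<close> by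
      \<open>m * \<bar>w c\<bar>\<close>. Since \<open>m < D\<close>, the whole row
      vanishes.\<close>
    have "Max ((\<lambda>b. \<bar>w b\<bar>) ` A) \<in> (\<lambda>b. \<bar>w b\<bar>) ` A" using fin a by (intro Max_in) auto
    then obtain c where c: "c \<in> A" and mx: "Max ((\<lambda>b. \<bar>w b\<bar>) ` A) = \<bar>w c\<bar>" by auto
    have le: "\<bar>w b\<bar> \<le> \<bar>w c\<bar>" if "b \<in> A" for b
      using that fin unfolding mx[symmetric] by (intro Max_ge) auto
    have "D * \<bar>w c\<bar> = \<bar>\<Sum>b\<in>A. w b * s b c\<bar>" using D0 eig[OF c] by (simp add: abs_mult)
    also have "\<dots> \<le> (\<Sum>b\<in>A. \<bar>w c\<bar> * s b c)"
      by (rule order_trans[OF sum_abs]) (intro sum_mono, simp add: abs_mult nonneg[OF _ c] le mult_right_mono)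
    also have "\<dots> = m * \<bar>w c\<bar>"
      by (simp add: sum_distrib_left[symmetric] colsum[OF c] flip: of_int_sum)
    finally have "(D - m) * \<bar>w c\<bar> \<le> 0" by (simp add: algebra_simps)
    then have "w c = 0" using Dm by (simp add: mult_le_0_iff)
    then have "w b = 0" using le[OF b] by simp
    then show ?thesis by (simp add: w_def)
  qed
  \<comment> \<open>A second index supplies the off-diagonal entry \<open>1 / k\<close>. Subtracting
    the diagonal entry shows that \<open>k\<close> is an integer, and a positive integer with
    integer reciprocal is 1.\<close>
  have "card (A - {a}) \<noteq> 0" using card fin a by simp
  then obtain b where b: "b \<in> A" "b \<noteq> a" by (metis card.empty ex_in_conv Diff_iff singletonI)
  have ik: "s a b = 1 / k" using entry[OF a b(1)] b(2) by simp
  have "s a a + k = s a b" using entry[OF a a] ik by simp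
  then have kint: "k = real_of_int (s a b - s a a)" by simp
  have "real_of_int (s a b * (s a b - s a a)) = 1"
    using ik k0 unfolding of_int_mult kint[symmetric] by simp
  then have "s a b * (s a b - s a a) = 1" by linarith
  moreover have "s a b - s a a > 0" using k0 kint by simp
  ultimately have "s a b - s a a = 1" by (metis zmult_eq_1_iff zero_less_one less_asym neg_less_0_iff_less)
  then have "k = 1" using kint by simp
  then have "real_of_int (s a c) = (if a = c then 0 else 1)" using entry[OF a c] by (simp split: if_splits)
  then show ?thesis by (simp split: if_splits)
qed

section \<open>Finite groups: prime order, exponent two, involutions\<close>

text \<open>By Lagrange any nonidentity element generates, so its powers give the isomorphism. This
  serves the case of order 3.\<close>

lemma (in group) prime_order_iso_integer_mod_group:
  assumes "prime (order G)"
  shows "G \<cong> integer_mod_group (order G)"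
proof -
  let ?p = "order G"
  have p1: "?p > 1" using assms prime_gt_1_nat by blast
  have fin: "finite (carrier G)" using p1 card.infinite unfolding order_def by fastforce
  have "\<not> carrier G \<subseteq> {\<one>}" using p1 card_mono[of "{\<one>}" "carrier G"] by (auto simp: order_def)
  then obtain x where x: "x \<in> carrier G" "x \<noteq> \<one>" by blast
  have "ord x dvd ?p" "ord x \<noteq> 1" using x ord_dvd_group_order ord_eq_1 by auto
  then have ord: "ord x = ?p" using assms by (auto simp: prime_nat_iff)
  let ?Z = "integer_mod_group ?p"
  have carZ: "carrier ?Z = {0..<int ?p}" using p1 by (simp add: carrier_integer_mod_group)
  have "(\<lambda>k::int. x [^] k) \<in> hom ?Z G"
  proof (rule homI)
    fix k l
    have "x [^] ((k + l) mod int ?p) = x [^] (k + l)"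
      using x(1) by (simp add: int_pow_eq ord mod_eq_dvd_iff[symmetric])
    then show "x [^] (k \<otimes>\<^bsub>?Z\<^esub> l) = x [^] k \<otimes> x [^] l"
      using x(1) by (simp add: int_pow_mult)
  qed (use x in auto)
  moreover have inj: "inj_on (\<lambda>k::int. x [^] k) (carrier ?Z)"
  proof (rule inj_onI)
    fix k l assume kl: "k \<in> carrier ?Z" "l \<in> carrier ?Z" and "x [^] k = x [^] l"
    then have "int ?p dvd k - l" using x(1) int_pow_eq ord by metis
    then have "k mod int ?p = l mod int ?p" by (simp add: mod_eq_dvd_iff)
    then show "k = l" using kl by (simp add: carZ)
  qed
  moreover have "(\<lambda>k::int. x [^] k) ` carrier ?Z = carrier G"
  proof (rule card_subset_eq[OF fin])
    show "card ((\<lambda>k::int. x [^] k) ` carrier ?Z) = card (carrier G)"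
      unfolding card_image[OF inj] unfolding carZ by (simp add: order_def)
  qed (use x in auto)
  ultimately have "(\<lambda>k::int. x [^] k) \<in> iso ?Z G" by (simp add: iso_def bij_betw_def)
  then have "?Z \<cong> G" by (rule is_isoI)
  then show ?thesis by (simp add: group.iso_sym)
qed

lemma carrier_group_power_C2:
  "carrier (group_power (integer_mod_group 2) n) = {..<n} \<rightarrow>\<^sub>E {0, 1}"
proof -
  have "{0..<2} = {0, 1 :: int}" by auto
  then show ?thesis by (simp add: carrier_integer_mod_group)
qed

lemma (in group) exponent_two_iso_group_power:
  assumes fin: "finite (carrier G)" and sq: "\<And>x. x \<in> carrier G \<Longrightarrow> x \<otimes> x = \<one>"
  obtains n where "G \<cong> group_power (integer_mod_group 2) n" "order G = 2 ^ n"
proof -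
  let ?P = "group_power (integer_mod_group 2)"
  let ?I = "\<lambda>n h. h \<in> hom (?P n) G \<and> inj_on h (carrier (?P n))"
  have comm: "x \<otimes> y = y \<otimes> x" if x: "x \<in> carrier G" and y: "y \<in> carrier G" for x y
  proof -
    have inv: "inv z = z" if "z \<in> carrier G" for z using inv_equality[OF sq[OF that] that that] .
    show ?thesis using inv_mult_group[OF x y] inv[OF m_closed[OF x y]] inv[OF x] inv[OF y] by simp
  qed
  interpret C: comm_group G by (rule group_comm_groupI) (rule comm)
  have card_P: "card (carrier (?P n)) = 2 ^ n" for n
    unfolding carrier_group_power_C2 by (simp add: card_PiE numeral_2_eq_2)
  \<comment> \<open>An embedding of a maximal power of \<open>C\<^sub>2\<close> is onto, since a missed element extends it.\<close>
  have step: "\<exists>g. ?I (Suc n) g" if I: "?I n h" and a: "a \<in> carrier G" "a \<notin> h ` carrier (?P n)" for n h a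
  proof -
    have hom: "h \<in> hom (?P n) G" and inj: "inj_on h (carrier (?P n))" using I by auto
    \<comment> \<open>The extension \<open>g\<close> of \<open>h\<close> treats the first
      \<open>n\<close> coordinates by \<open>h\<close> and sends the new generator to
      \<open>a\<close>. Elements of the product are extensional functions, so dropping a coordinate
      means restricting.\<close>
    define e where "e k = (if k = 0 then \<one> else a)" for k :: int
    define r where "r x = restrict x {..<n}" for x :: "nat \<Rightarrow> int"
    define g where "g x = h (r x) \<otimes> e (x n)" for x
    have r: "r x \<in> carrier (?P n)" and xn: "x n = 0 \<or> x n = 1" if "x \<in> carrier (?P (Suc n))" for x
      using that unfolding carrier_group_power_C2 r_def by (auto simp: PiE_iff)
    have hr: "h (r x) \<in> carrier G" if "x \<in> carrier (?P (Suc n))" for x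
      using hom_in_carrier[OF hom r[OF that]] .
    have e: "e k \<in> carrier G" for k using a by (simp add: e_def)
    have e_mult: "e ((k + l) mod 2) = e k \<otimes> e l" if "k = 0 \<or> k = 1" "l = 0 \<or> l = 1" for k l
      using that a sq by (auto simp: e_def)
    have "g \<in> hom (?P (Suc n)) G"
    proof (rule homI)
      fix x y assume x: "x \<in> carrier (?P (Suc n))" and y: "y \<in> carrier (?P (Suc n))"
      have "r (x \<otimes>\<^bsub>?P (Suc n)\<^esub> y) = r x \<otimes>\<^bsub>?P n\<^esub> r y" by (auto simp: r_def fun_eq_iff)
      then have "g (x \<otimes>\<^bsub>?P (Suc n)\<^esub> y) = (h (r x) \<otimes> h (r y)) \<otimes> (e (x n) \<otimes> e (y n))"
        using hom_mult[OF hom r[OF x] r[OF y]] e_mult[OF xn[OF x] xn[OF y]] by (simp add: g_def)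
      also have "\<dots> = g x \<otimes> g y"
        unfolding g_def using hr[OF x] hr[OF y] e by (simp add: C.m_ac)
      finally show "g (x \<otimes>\<^bsub>?P (Suc n)\<^esub> y) = g x \<otimes> g y" .
    qed (use hr e in \<open>simp add: g_def\<close>)
    moreover have "inj_on g (carrier (?P (Suc n)))"
    proof (rule inj_onI)
      fix x y assume x: "x \<in> carrier (?P (Suc n))" and y: "y \<in> carrier (?P (Suc n))" and eq: "g x = g y"
      have "h (r x \<otimes>\<^bsub>?P n\<^esub> r y) = h (r x) \<otimes> h (r y)" by (rule hom_mult[OF hom r[OF x] r[OF y]])
      moreover have "r x \<otimes>\<^bsub>?P n\<^esub> r y \<in> carrier (?P n)"
        by (rule monoid.m_closed[OF group.is_monoid r[OF x] r[OF y]]) simp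
      ultimately have xy: "h (r x) \<otimes> h (r y) \<in> h ` carrier (?P n)" by (metis imageI)
      \<comment> \<open>If the last coordinates differed, exactly one side of
        \<open>g x = g y\<close> would contain \<open>a\<close>. Since squares are trivial,
        \<open>a\<close> would be \<open>h (r x) \<otimes> h (r y)\<close>, an element of the image
        of \<open>h\<close>.\<close>
      have "x n = y n"
      proof (rule ccontr)
        assume "x n \<noteq> y n"
        with xn[OF x] xn[OF y] eq hr[OF x] hr[OF y] a(1) have "h (r x) \<otimes> a = h (r y) \<or> h (r x) = h (r y) \<otimes> a"
          by (auto simp: g_def e_def)
        then have "h (r x) \<otimes> h (r y) = a"
        proof
          assume "h (r x) \<otimes> a = h (r y)"
          then have "h (r x) \<otimes> h (r y) = (h (r x) \<otimes> h (r x)) \<otimes> a"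
            using hr[OF x] a(1) by (simp add: m_assoc)
          then show ?thesis using sq[OF hr[OF x]] a(1) by simp
        next
          assume "h (r x) = h (r y) \<otimes> a"
          then have "h (r x) \<otimes> h (r y) = (h (r y) \<otimes> h (r y)) \<otimes> a"
            using hr[OF y] a(1) by (simp add: C.m_ac)
          then show ?thesis using sq[OF hr[OF y]] a(1) by simp
        qed
        then show False using xy a(2) by simp
      qed
      then have "h (r x) = h (r y)" using eq hr[OF x] hr[OF y] e by (simp add: g_def)
      then have "r x = r y" using inj r[OF x] r[OF y] by (simp add: inj_on_eq_iff)
      then have "x i = y i" if "i < n" for i using that by (metis lessThan_iff r_def restrict_apply')
      then show "x = y" using x y \<open>x n = y n\<close> unfolding carrier_group_power_C2
        by (intro PiE_ext[of x _ _ y]) (auto simp: less_Suc_eq)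
    qed
    ultimately show ?thesis by blast
  qed
  \<comment> \<open>An embedded power has at most \<open>order G\<close> elements, so the admissible
    exponents are bounded and a greatest one exists.\<close>
  have bound: "n \<le> order G" if "?I n h" for n h
  proof -
    have "h ` carrier (?P n) \<subseteq> carrier G" using that hom_carrier by blast
    then have "2 ^ n \<le> order G"
      unfolding order_def card_P[symmetric] using that by (intro card_inj_on_le[OF _ _ fin]) auto
    moreover have "n \<le> 2 ^ n" by simp
    ultimately show ?thesis by linarith
  qed
  define Q where "Q n \<longleftrightarrow> (\<exists>h. ?I n h)" for n
  have "?I 0 (\<lambda>_. \<one>)"
    unfolding carrier_group_power_C2 by (intro conjI homI) simp_all
  then have Q0: "Q 0" unfolding Q_def by (rule exI[where x = "\<lambda>_. \<one>"])
  have Q_bound: "n \<le> order G" if "Q n" for n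
    using that unfolding Q_def by (elim exE) (rule bound)
  obtain n where Qn: "Q n" and max: "\<And>k. Q k \<Longrightarrow> k \<le> n"
    using ex_has_greatest_nat[of Q 0 "\<lambda>n. n" "Suc (order G)"] Q0 Q_bound
    by (auto simp: less_Suc_eq_le)
  obtain h where h: "?I n h" using Qn unfolding Q_def by (elim exE)
  have "carrier G \<subseteq> h ` carrier (?P n)"
  proof (rule subsetI, rule ccontr)
    fix a assume a: "a \<in> carrier G" and "a \<notin> h ` carrier (?P n)"
    then have "Q (Suc n)" unfolding Q_def by (rule step[OF h])
    then show False using max[of "Suc n"] by simp
  qed
  moreover have "h ` carrier (?P n) \<subseteq> carrier G" by (rule hom_carrier) (rule conjunct1[OF h])
  ultimately have "h ` carrier (?P n) = carrier G" by (rule subset_antisym[rotated])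
  then have "h \<in> iso (?P n) G" using h unfolding iso_def bij_betw_def by blast
  then have iso: "?P n \<cong> G" by (rule is_isoI)
  then have "order G = 2 ^ n" using iso_same_card[OF iso] card_P by (simp add: order_def)
  moreover have "G \<cong> ?P n" by (rule group.iso_sym[OF _ iso]) simp
  ultimately show ?thesis using that by blast
qed

lemma (in group) even_order_involution:
  assumes "even (order G)" "finite (carrier G)"
  obtains x where "x \<in> carrier G" "x \<noteq> \<one>" "x \<otimes> x = \<one>"
proof -
  \<comment> \<open>Here \<open>m\<close> may still be even: only a subgroup of order exactly two is
    wanted, not a full Sylow subgroup.\<close>
  obtain m where "order G = 2 ^ 1 * m" using assms(1) by auto
  from sylow_thm[OF two_is_prime_nat is_group this assms(2)]
  obtain H where H: "subgroup H G" "card H = 2" by auto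
  have "\<one> \<in> H" by (rule subgroup.one_closed[OF H(1)])
  then have "card (H - {\<one>}) = 1" using H(2) by simp
  then obtain x where "H - {\<one>} = {x}" by (auto simp: card_1_singleton_iff)
  then have "x \<in> H" "x \<noteq> \<one>" and H2: "H = {\<one>, x}" using \<open>\<one> \<in> H\<close> by auto
  moreover from this have "x \<otimes> x \<noteq> x" using subgroup.mem_carrier[OF H(1)] by simp
  ultimately show ?thesis
    using that subgroup.m_closed[OF H(1), of x x] subgroup.mem_carrier[OF H(1)] by auto
qed

section \<open>Coordinates and structure constants\<close>

context fusion_ring begin

abbreviation N :: "'a \<Rightarrow> 'a \<Rightarrow> 'a \<Rightarrow> int" where
  "N a b \<equiv> basis_coord R B (a \<otimes> b)"

lemma basisD [simp]: "b \<in> B \<Longrightarrow> b \<in> carrier R"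
  using basis_closed by auto

lemma coord_inject:
  assumes "x \<in> carrier R" "y \<in> carrier R" "\<And>b. b \<in> B \<Longrightarrow> basis_coord R B x b = basis_coord R B y b"
  shows "x = y"
proof -
  have "basis_coord R B x = basis_coord R B y"
    by (rule PiE_ext[OF coord(1)[OF assms(1)] coord(1)[OF assms(2)] assms(3)])
  then show ?thesis using coord(2)[OF assms(1)] coord(2)[OF assms(2)] by simp
qed

lemma comb_closed: "f \<in> B \<rightarrow> carrier R \<Longrightarrow> (\<Oplus>b\<in>B. [(c b :: int)] \<cdot> f b) \<in> carrier R"
  by (intro finsum_closed) (auto intro!: add.int_pow_closed)

lemma coord_add:
  assumes "x \<in> carrier R" "y \<in> carrier R" "b \<in> B"
  shows "basis_coord R B (x \<oplus> y) b = basis_coord R B x b + basis_coord R B y b"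
proof (rule coord_eq)
  let ?c = "basis_coord R B"
  have "x \<oplus> y = (\<Oplus>b\<in>B. [?c x b] \<cdot> b) \<oplus> (\<Oplus>b\<in>B. [?c y b] \<cdot> b)"
    using coord(2)[OF assms(1)] coord(2)[OF assms(2)] by simp
  also have "\<dots> = (\<Oplus>b\<in>B. [?c x b] \<cdot> b \<oplus> [?c y b] \<cdot> b)"
    by (subst finsum_addf) (auto intro!: add.int_pow_closed)
  also have "\<dots> = (\<Oplus>b\<in>B. [(?c x b + ?c y b)] \<cdot> b)"
    by (intro finsum_cong') (auto simp: add.int_pow_mult intro!: add.int_pow_closed)
  finally show "x \<oplus> y = (\<Oplus>b\<in>B. [(?c x b + ?c y b)] \<cdot> b)" .
qed (use assms in auto)

lemma coord_zero: "b \<in> B \<Longrightarrow> basis_coord R B \<zero> b = 0"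
  using coord_add[of \<zero> \<zero> b] by simp

lemma coord_basis:
  assumes "b \<in> B" "a \<in> B"
  shows "basis_coord R B b a = (if a = b then 1 else 0)"
proof (rule coord_eq)
  have "(\<Oplus>a\<in>B. [(if a = b then 1 else 0 :: int)] \<cdot> a) = (\<Oplus>a\<in>B. if b = a then a else \<zero>)"
    by (intro finsum_cong') (auto simp: add_pow_def int_pow_def2)
  also have "\<dots> = b"
    using finsum_singleton[OF assms(1) finite_basis, of "\<lambda>a. a"] by simp
  finally show "b = (\<Oplus>a\<in>B. [(if a = b then 1 else 0 :: int)] \<cdot> a)" by simp
qed (use assms in auto)

lemma coord_finsum:
  assumes "finite I" "f \<in> I \<rightarrow> carrier R" "b \<in> B"
  shows "basis_coord R B (\<Oplus>i\<in>I. f i) b = (\<Sum>i\<in>I. basis_coord R B (f i) b)"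
  using assms(1,2) by induct (auto simp: coord_zero coord_add assms(3) Pi_def)

lemma coord_int_pow:
  assumes "x \<in> carrier R" "b \<in> B"
  shows "basis_coord R B ([(k :: int)] \<cdot> x) b = k * basis_coord R B x b"
proof -
  have "(\<lambda>x. basis_coord R B x b) \<in> hom (add_monoid R) integer_group"
    using assms by (intro homI) (auto simp: integer_group_def coord_add)
  from hom_int_pow[OF this _ add.group_axioms group_integer_group, of x k] assms
  show ?thesis by (simp add: add_pow_def)
qed

lemma coord_mult_left:
  assumes "x \<in> carrier R" "y \<in> carrier R" "c \<in> B"
  shows "basis_coord R B (x \<otimes> y) c = (\<Sum>a\<in>B. basis_coord R B x a * basis_coord R B (a \<otimes> y) c)"
proof -
  have "x \<otimes> y = (\<Oplus>a\<in>B. [basis_coord R B x a] \<cdot> a) \<otimes> y" using coord(2)[OF assms(1)] by simp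
  also have "\<dots> = (\<Oplus>a\<in>B. [basis_coord R B x a] \<cdot> (a \<otimes> y))"
    using assms by (subst finsum_ldistr[OF finite_basis])
      (auto simp: add_pow_ldistr_int intro!: add.int_pow_closed finsum_cong')
  finally show ?thesis
    using assms by (simp add: coord_finsum[OF finite_basis] coord_int_pow Pi_def add.int_pow_closed)
qed

lemma coord_mult_right:
  assumes "x \<in> carrier R" "y \<in> carrier R" "c \<in> B"
  shows "basis_coord R B (x \<otimes> y) c = (\<Sum>b\<in>B. basis_coord R B y b * basis_coord R B (x \<otimes> b) c)"
proof -
  have "x \<otimes> y = x \<otimes> (\<Oplus>b\<in>B. [basis_coord R B y b] \<cdot> b)" using coord(2)[OF assms(2)] by simp
  also have "\<dots> = (\<Oplus>b\<in>B. [basis_coord R B y b] \<cdot> (x \<otimes> b))"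
    using assms by (subst finsum_rdistr[OF finite_basis])
      (auto simp: add_pow_rdistr_int intro!: add.int_pow_closed finsum_cong')
  finally show ?thesis
    using assms by (simp add: coord_finsum[OF finite_basis] coord_int_pow Pi_def add.int_pow_closed)
qed

text \<open>Both sides are the coefficient of \<open>d\<close> in the triple product of
  \<open>a\<close>, \<open>b\<close> and \<open>c\<close>, bracketed in the two ways.\<close>

lemma N_assoc:
  assumes "a \<in> B" "b \<in> B" "c \<in> B" "d \<in> B"
  shows "(\<Sum>y\<in>B. N a b y * N y c d) = (\<Sum>y\<in>B. N b c y * N a y d)"
  using assms coord_mult_left[of "a \<otimes> b" c d] coord_mult_right[of a "b \<otimes> c" d]
  by (simp add: m_assoc)

text \<open>The duality axiom makes 1 the coefficient of the unit in
  \<open>star \<one> \<otimes> \<one>\<close>, which is the basis element \<open>star \<one>\<close>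
  itself.\<close>

lemma star_one: "star \<one> = \<one>"
  using structure_consts_one[of "star \<one>" \<one>] one_in_basis star_closed[OF one_in_basis]
  by (simp add: coord_basis split: if_splits)

text \<open>Frobenius reciprocity: the coefficient of \<open>\<one>\<close> in
  \<open>x \<otimes> a \<otimes> star b\<close>, computed with either bracketing, collapses to a
  single structure constant.\<close>

lemma N_frobenius:
  assumes "x \<in> B" "a \<in> B" "b \<in> B"
  shows "N x a b = N a (star b) (star x)"
proof -
  have "(\<Sum>y\<in>B. N x a y * N y (star b) \<one>) = (\<Sum>y\<in>B. if y = b then N x a y else 0)"
    using assms by (intro sum.cong) (auto simp: structure_consts_one star_closed star_star)
  moreover have "(\<Sum>y\<in>B. N a (star b) y * N x y \<one>) = (\<Sum>y\<in>B. if y = star x then N a (star b) y else 0)"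
    using assms by (intro sum.cong) (auto simp: structure_consts_one star_closed star_star)
  ultimately show ?thesis
    using N_assoc[of x a "star b" \<one>] assms by (simp add: one_in_basis star_closed finite_basis)
qed

section \<open>Automorphisms preserve the unit and the structure constants\<close>

lemma fusion_Aut_iff:
  "f \<in> carrier (fusion_Aut R B) \<longleftrightarrow> f \<in> Bij B \<and> lin_ext R B f \<in> ring_iso R R"
  by (simp add: fusion_Aut_def)

lemma Aut_bij: "f \<in> carrier (fusion_Aut R B) \<Longrightarrow> bij_betw f B B"
  by (simp add: fusion_Aut_iff Bij_def)

lemma Aut_closed: "f \<in> carrier (fusion_Aut R B) \<Longrightarrow> b \<in> B \<Longrightarrow> f b \<in> B"
  using Aut_bij bij_betwE by metis

lemma Aut_lin_ext: "f \<in> carrier (fusion_Aut R B) \<Longrightarrow> b \<in> B \<Longrightarrow> lin_ext R B f b = f b"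
  by (rule lin_ext_basis) (simp add: Pi_def Aut_closed)

lemma Aut_one:
  assumes "f \<in> carrier (fusion_Aut R B)"
  shows "f \<one> = \<one>"
  using assms Aut_lin_ext[OF assms one_in_basis] ring_hom_one[of "lin_ext R B f" R R]
  by (simp add: fusion_Aut_iff ring_iso_def)

lemma Aut_mult:
  assumes "f \<in> carrier (fusion_Aut R B)" "a \<in> B" "b \<in> B"
  shows "f a \<otimes> f b = lin_ext R B f (a \<otimes> b)"
  using assms ring_hom_mult[of "lin_ext R B f" R R a b]
  by (simp add: fusion_Aut_iff ring_iso_def Aut_lin_ext)

lemma N_Aut:
  assumes f: "f \<in> carrier (fusion_Aut R B)" and "a \<in> B" "b \<in> B" "c \<in> B"
  shows "N (f a) (f b) (f c) = N a b c"
proof -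
  note fc = Aut_closed[OF f]
  have "N (f a) (f b) (f c) = (\<Sum>d\<in>B. N a b d * basis_coord R B (f d) (f c))"
    unfolding Aut_mult[OF assms(1-3)] lin_ext_def
    using assms by (simp add: coord_finsum[OF finite_basis] coord_int_pow fc Pi_def add.int_pow_closed)
  also have "\<dots> = (\<Sum>d\<in>B. if d = c then N a b d else 0)"
    using assms Aut_bij[OF f]
    by (intro sum.cong) (auto simp: coord_basis fc bij_betw_def inj_on_eq_iff)
  also have "\<dots> = N a b c" using assms by (simp add: finite_basis)
  finally show ?thesis .
qed

lemma bij_betw_nonunit_basis:
  assumes "f \<in> carrier (fusion_Aut R B)"
  shows "bij_betw f (B - {\<one>}) (B - {\<one>})"
  using bij_betw_DiffI[OF Aut_bij[OF assms], of "{\<one>}" "{\<one>}"] Aut_one[OF assms] one_in_basis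
  by (simp add: bij_betw_def)

section \<open>Consequences of transitivity on the nonunit basis elements\<close>

text \<open>With \<sigma> the sum of the nonunit basis elements, the left side is the coefficient of
  \<open>c\<close> in \<sigma> times \<open>a\<close>. These coefficients form a matrix to which
  \<open>quadratic_constant_colsum_matrix\<close> applies.\<close>

lemma transitive_Aut_sum_N:
  assumes aut_trans: "\<And>a b. a \<in> B - {\<one>} \<Longrightarrow> b \<in> B - {\<one>} \<Longrightarrow>
      \<exists>f \<in> carrier (fusion_Aut R B). f a = b"
    and card: "card (B - {\<one>}) \<ge> 2" and a: "a \<in> B - {\<one>}" and c: "c \<in> B - {\<one>}"
  shows "(\<Sum>x\<in>B - {\<one>}. N x a c) = (if a = c then 0 else 1)"
proof -
  define A where "A = B - {\<one>}"
  define s where "s a c = (\<Sum>x\<in>A. N x a c)" for a c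
  have AB: "x \<in> B" "x \<noteq> \<one>" if "x \<in> A" for x using that by (auto simp: A_def)
  have finA: "finite A" by (simp add: A_def finite_basis)
  have splitB: "(\<Sum>x\<in>B. g x) = g \<one> + (\<Sum>x\<in>A. g x)" for g :: "'a \<Rightarrow> int"
    unfolding A_def by (rule sum.remove[OF finite_basis one_in_basis])
  have starA: "star x \<in> A" if "x \<in> A" for x
    using AB[OF that] star_closed star_star star_one unfolding A_def by force
  \<comment> \<open>The unit occurs in \<open>x \<otimes> a\<close> only for
    \<open>x = star a\<close>, which is again a nonunit.\<close>
  have s_one: "s a \<one> = 1" if "a \<in> A" for a
  proof -
    have "s a \<one> = (\<Sum>x\<in>A. if x = star a then 1 else 0)"
      unfolding s_def using AB that by (intro sum.cong) (auto simp: structure_consts_one)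
    then show ?thesis using finA starA[OF that] by simp
  qed
  \<comment> \<open>The coefficients of \<open>\<sigma>\<^sup>2\<close>.\<close>
  define t where "t z = (\<Sum>x\<in>A. \<Sum>y\<in>A. N x y z)" for z
  have t_swap: "t z = (\<Sum>a\<in>A. s a z)" for z unfolding t_def s_def by (rule sum.swap)
  have t_one: "t \<one> = card A" unfolding t_swap by (simp add: s_one)
  have "t (f z) = t z" if f: "f \<in> carrier (fusion_Aut R B)" and z: "z \<in> A" for f z
  proof -
    note bij = bij_betw_nonunit_basis[OF f, folded A_def]
    have "t (f z) = (\<Sum>x\<in>A. \<Sum>y\<in>A. N (f x) y (f z))"
      unfolding t_def by (rule sum.reindex_bij_betw[OF bij, symmetric])
    also have "\<dots> = (\<Sum>x\<in>A. \<Sum>y\<in>A. N (f x) (f y) (f z))"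
      by (rule sum.cong[OF refl], rule sum.reindex_bij_betw[OF bij, symmetric])
    also have "\<dots> = t z"
      unfolding t_def by (rule sum.cong[OF refl], rule sum.cong[OF refl]) (simp add: N_Aut f AB z)
    finally show ?thesis .
  qed
  then have t_const: "t z = t a" if "z \<in> A" for z
    using aut_trans[of a z] that a by (auto simp: A_def)
  \<comment> \<open>Both sides are the coefficient of \<open>v\<close> in \<sigma> \<sigma>
    \<open>u\<close>. The leading 1 is the contribution of \<open>b = \<one>\<close>, missing from
    the sum over \<open>A\<close>; on the right, \<sigma> \<sigma> is split into its unit part and
    the constant \<open>t a\<close> elsewhere.\<close>
  have quad: "1 + (\<Sum>b\<in>A. s u b * s b v) = (if u = v then int (card A) else 0) + t a * s u v"
    if u: "u \<in> A" and v: "v \<in> A" for u v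
  proof -
    have "s \<one> v = (\<Sum>x\<in>A. if x = v then 1 else 0)"
      unfolding s_def using AB v by (intro sum.cong) (auto simp: coord_basis)
    then have "s \<one> v = 1" using finA v by simp
    then have "1 + (\<Sum>b\<in>A. s u b * s b v) = (\<Sum>b\<in>B. s u b * s b v)"
      by (simp add: splitB s_one[OF u])
    also have "\<dots> = (\<Sum>b\<in>B. \<Sum>x\<in>A. \<Sum>y\<in>A. N y u b * N x b v)"
      unfolding s_def sum_product by (rule sum.cong[OF refl], rule sum.swap)
    also have "\<dots> = (\<Sum>x\<in>A. \<Sum>y\<in>A. \<Sum>b\<in>B. N y u b * N x b v)"
      by (rule trans[OF sum.swap], rule sum.cong[OF refl], rule sum.swap)
    also have "\<dots> = (\<Sum>x\<in>A. \<Sum>y\<in>A. \<Sum>z\<in>B. N x y z * N z u v)"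
      by (rule sum.cong[OF refl], rule sum.cong[OF refl], rule N_assoc[symmetric]) (use AB u v in auto)
    also have "\<dots> = (\<Sum>z\<in>B. \<Sum>x\<in>A. \<Sum>y\<in>A. N x y z * N z u v)"
      by (rule sym, rule trans[OF sum.swap], rule sum.cong[OF refl], rule sum.swap)
    also have "\<dots> = (\<Sum>z\<in>B. t z * N z u v)"
      by (simp add: t_def sum_distrib_right)
    also have "\<dots> = card A * N \<one> u v + (\<Sum>z\<in>A. t a * N z u v)"
      unfolding splitB t_one
      by (rule arg_cong[of _ _ "(+) _"], rule sum.cong[OF refl]) (simp only: t_const)
    also have "\<dots> = (if u = v then int (card A) else 0) + t a * s u v"
      using AB u v by (simp add: s_def sum_distrib_left coord_basis)
    finally show ?thesis .
  qed
  have "s a c = (if a = c then 0 else 1)"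
  proof (rule quadratic_constant_colsum_matrix[OF finA _ _ _ quad])
    \<comment> \<open>The column sum at \<open>v\<close> is the coefficient of \<open>v\<close> in
      the square of \<sigma>, so the column sums are constant by transitivity.\<close>
    show "(\<Sum>u\<in>A. s u v) = t a" if "v \<in> A" for v
      using t_const[OF that] by (simp only: t_swap)
    show "0 \<le> s u v" if "u \<in> A" "v \<in> A" for u v
      unfolding s_def using that AB structure_consts_nonneg by (intro sum_nonneg) auto
  qed (use card a c in \<open>simp_all add: A_def\<close>)
  then show ?thesis by (simp add: s_def A_def)
qed

text \<open>By Frobenius reciprocity the previous sum runs over the coefficients of
  \<open>a \<otimes> b\<close> at nonunits: it is 0 if \<open>a = star b\<close>, where the unit has
  coefficient 1, and 1 otherwise, where the unit has coefficient 0. So the nonnegative integer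
  coefficients of \<open>a \<otimes> b\<close> add up to 1.\<close>

lemma transitive_Aut_basis_closed:
  assumes aut_trans: "\<And>a b. a \<in> B - {\<one>} \<Longrightarrow> b \<in> B - {\<one>} \<Longrightarrow>
      \<exists>f \<in> carrier (fusion_Aut R B). f a = b"
    and card: "card (B - {\<one>}) \<ge> 2" and a: "a \<in> B" and b: "b \<in> B"
  shows "a \<otimes> b \<in> B"
proof (cases "a = \<one> \<or> b = \<one>")
  case True
  then show ?thesis using a b by auto
next
  case False
  let ?A = "B - {\<one>}"
  define c where "c = star b"
  have c: "c \<in> ?A" and star_c: "star c = b"
    using False b star_one star_star[OF b] star_closed[OF b] unfolding c_def by force+
  have ab: "a \<in> ?A" using False a by simp
  have nn: "N x a c \<ge> 0" if "x \<in> ?A" for x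
    using that ab c structure_consts_nonneg by auto
  have star_bij: "\<exists>x\<in>B. star x = y" if "y \<in> B" for y using that star_closed star_star by metis
  have sum: "(\<Sum>x\<in>?A. N x a c) = (if a = c then 0 else 1)"
    by (rule transitive_Aut_sum_N[OF aut_trans card ab c])
  have N_star: "N a b (star x) = N x a c" if "x \<in> B" for x
    using N_frobenius[of x a c] that a c star_c by simp
  have N_one: "N a b \<one> = (if a = c then 1 else 0)"
    using a b by (simp add: structure_consts_one c_def)
  \<comment> \<open>Reciprocity yields coefficients at starred elements, so the product is found as
    \<open>star x\<close>.\<close>
  have "\<exists>x\<in>B. \<forall>y\<in>B. N a b (star y) = (if y = x then 1 else 0)"
  proof (cases "a = c")
    case True
    then have "N x a c = 0" if "x \<in> ?A" for x
      using sum_nonneg_eq_0_iff[of ?A "\<lambda>x. N x a c"] nn sum that finite_basis by simp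
    then show ?thesis using N_one N_star True star_one one_in_basis
      by (intro bexI[of _ \<one>]) (metis DiffI singletonD)+
  next
    case False
    then have sum1: "(\<Sum>x\<in>?A. N x a c) = 1" using sum by simp
    then obtain x where x: "x \<in> ?A" "N x a c \<noteq> 0" by (metis sum.neutral zero_neq_one)
    have rest: "(\<Sum>y\<in>?A - {x}. N y a c) = 1 - N x a c"
      using sum1 sum.remove[of ?A x "\<lambda>x. N x a c"] x(1) finite_basis by simp
    moreover have "(\<Sum>y\<in>?A - {x}. N y a c) \<ge> 0" using nn by (intro sum_nonneg) auto
    ultimately have one: "N x a c = 1" using nn[OF x(1)] x(2) by simp
    have "N y a c = 0" if "y \<in> ?A - {x}" for y
      using sum_nonneg_eq_0_iff[of "?A - {x}" "\<lambda>x. N x a c"] nn rest one that finite_basis by simp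
    moreover have "N \<one> a c = 0" using N_one N_star[OF one_in_basis] False star_one by simp
    ultimately show ?thesis using x(1) one N_star
      by (intro bexI[of _ x]) (metis DiffI DiffD1 singletonD)+
  qed
  then obtain x where x: "x \<in> B" and *: "\<And>y. y \<in> B \<Longrightarrow> N a b (star y) = (if y = x then 1 else 0)"
    by blast
  have "a \<otimes> b = star x"
  proof (rule coord_inject)
    fix y assume "y \<in> B"
    then show "N a b y = basis_coord R B (star x) y"
      using *[of "star y"] x by (simp add: coord_basis star_closed star_star) (metis star_star)
  qed (use a b x star_closed in auto)
  then show ?thesis using x star_closed by simp
qed

section \<open>The basis as a group, and its group ring\<close>

text \<open>In general not a group; it becomes one when \<open>B\<close> is closed under
  multiplication. Keeping the element type of \<open>R\<close> lets it witness the group asked for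
  in the theorem.\<close>

definition basis_group :: "'a monoid" where
  "basis_group = \<lparr>carrier = B, monoid.mult = (\<otimes>), one = \<one>\<rparr>"

lemma basis_group_simps [simp]:
  "carrier basis_group = B" "x \<otimes>\<^bsub>basis_group\<^esub> y = x \<otimes> y" "\<one>\<^bsub>basis_group\<^esub> = \<one>"
  by (simp_all add: basis_group_def)

text \<open>The inverse of \<open>b\<close> is \<open>star b\<close>: their product is a basis
  element with nonzero unit coefficient, hence the unit.\<close>

lemma group_basis_group:
  assumes closed: "\<And>a b. a \<in> B \<Longrightarrow> b \<in> B \<Longrightarrow> a \<otimes> b \<in> B"
  shows "group basis_group"
proof (rule groupI; simp add: one_in_basis closed)
  fix b assume b: "b \<in> B"
  have "N (star b) b \<one> = 1" using b by (simp add: structure_consts_one star_closed)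
  then have "star b \<otimes> b = \<one>"
    using coord_basis[OF closed[OF star_closed[OF b] b] one_in_basis] by (simp split: if_splits)
  then show "\<exists>a\<in>B. a \<otimes> b = \<one>" using star_closed[OF b] by blast
qed (simp add: m_assoc)

lemma fusion_ring_iso_group_ring:
  assumes closed: "\<And>a b. a \<in> B \<Longrightarrow> b \<in> B \<Longrightarrow> a \<otimes> b \<in> B"
  shows "fusion_ring_iso R B (group_ring basis_group) (group_ring_basis basis_group)"
proof -
  let ?S = "group_ring basis_group"
  \<comment> \<open>The coordinate map, with value 0 outside \<open>B\<close> because elements of
    the group ring vanish off the group.\<close>
  define h where "h x = (\<lambda>b. if b \<in> B then basis_coord R B x b else 0)" for x
  have carS: "carrier ?S = {f. \<forall>x. x \<notin> B \<longrightarrow> f x = 0}" by (simp add: group_ring_def)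
  have h_basis: "h b = group_ring_elt b" if "b \<in> B" for b
    using that by (auto simp: h_def group_ring_elt_def coord_basis fun_eq_iff)
  have "h \<in> ring_hom R ?S"
  proof (rule ring_hom_memI)
    fix x y assume x: "x \<in> carrier R" and y: "y \<in> carrier R"
    show "h x \<in> carrier ?S" by (simp add: carS h_def)
    show "h (x \<oplus> y) = h x \<oplus>\<^bsub>?S\<^esub> h y"
      using x y by (auto simp: h_def group_ring_def coord_add fun_eq_iff)
    show "h (x \<otimes> y) = h x \<otimes>\<^bsub>?S\<^esub> h y"
    proof
      fix c
      have M: "(h x \<otimes>\<^bsub>?S\<^esub> h y) c = (\<Sum>a\<in>B. \<Sum>b\<in>B. if a \<otimes> b = c then h x a * h y b else 0)"
        by (subst group_ring_mult) (simp_all add: finite_basis)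
      show "h (x \<otimes> y) c = (h x \<otimes>\<^bsub>?S\<^esub> h y) c"
      proof (cases "c \<in> B")
        case True
        have "h (x \<otimes> y) c = (\<Sum>a\<in>B. basis_coord R B x a * basis_coord R B (a \<otimes> y) c)"
          using True x y by (simp only: h_def if_True coord_mult_left[OF x y])
        also have "\<dots> = (\<Sum>a\<in>B. basis_coord R B x a * (\<Sum>b\<in>B. basis_coord R B y b * N a b c))"
          using True x y by (intro sum.cong refl arg_cong[of _ _ "(*) _"] coord_mult_right) auto
        \<comment> \<open>As \<open>a \<otimes> b\<close> is a basis element, \<open>N a b\<close>
          is its indicator function, which turns the sum into the convolution.\<close>
        also have "\<dots> = (h x \<otimes>\<^bsub>?S\<^esub> h y) c"
          unfolding M sum_distrib_left
          by (intro sum.cong refl) (use True closed in \<open>auto simp: h_def coord_basis\<close>)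
        finally show ?thesis .
      next
        case False
        have "(h x \<otimes>\<^bsub>?S\<^esub> h y) c = 0"
          unfolding M using False closed by (intro sum.neutral ballI) auto
        then show ?thesis using False by (simp add: h_def)
      qed
    qed
  next
    show "h \<one> = \<one>\<^bsub>?S\<^esub>"
      by (simp add: h_basis one_in_basis group_ring_def group_ring_elt_def)
  qed
  moreover have "inj_on h (carrier R)"
    by (rule inj_onI, rule coord_inject) (auto simp: h_def fun_eq_iff split: if_splits)
  moreover have "f \<in> h ` carrier R" if f: "f \<in> carrier ?S" for f
  proof
    let ?x = "\<Oplus>b\<in>B. [f b] \<cdot> b"
    show x: "?x \<in> carrier R" by (intro comb_closed) simp
    show "f = h ?x" using f coord_eq[OF x refl] by (auto simp: h_def carS)
  qed
  ultimately have "h \<in> ring_iso R ?S"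
    by (auto simp: ring_iso_def bij_betw_def ring_hom_def)
  moreover have "h ` B = group_ring_basis basis_group"
    by (simp add: group_ring_basis_def h_basis)
  ultimately show ?thesis by (auto simp: fusion_ring_iso_def)
qed

section \<open>Orbits of a fixed-point-free automorphism of prime order\<close>

lemma aut_group_action:
  assumes "\<phi> \<in> carrier (fusion_Aut R B)"
  shows "group_action (subgroup_generated (fusion_Aut R B) {\<phi>}) B (\<lambda>\<psi>. \<psi>)"
proof -
  interpret A: group "fusion_Aut R B" by (rule group_fusion_Aut)
  have "carrier (subgroup_generated (fusion_Aut R B) {\<phi>}) \<subseteq> carrier (BijGroup B)"
    using A.carrier_subgroup_generated_subset[of "{\<phi>}"] fusion_Aut_iff by (auto simp: BijGroup_def)
  then have "(\<lambda>\<psi>. \<psi>) \<in> hom (subgroup_generated (fusion_Aut R B) {\<phi>}) (BijGroup B)"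
    by (auto simp: hom_def fusion_Aut_def)
  then show ?thesis
    by (simp add: group_action_def group_hom_def group_hom_axioms_def group_BijGroup)
qed

text \<open>The orbit size divides a prime by the orbit-stabilizer theorem, and it is not 1 because
  \<open>\<phi>\<close> moves \<open>b\<close>.\<close>

lemma card_aut_orbit:
  assumes \<phi>: "\<phi> \<in> carrier (fusion_Aut R B)" and fpf: "fixed_point_free R B \<phi>"
    and prime: "prime (group.ord (fusion_Aut R B) \<phi>)" and b: "b \<in> B - {\<one>}"
  shows "card (orbit (subgroup_generated (fusion_Aut R B) {\<phi>}) (\<lambda>\<psi>. \<psi>) b)
    = group.ord (fusion_Aut R B) \<phi>"
proof -
  interpret A: group "fusion_Aut R B" by (rule group_fusion_Aut)
  let ?H = "subgroup_generated (fusion_Aut R B) {\<phi>}"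
  interpret H: group_action ?H B "\<lambda>\<psi>. \<psi>" by (rule aut_group_action[OF \<phi>])
  let ?O = "orbit ?H (\<lambda>\<psi>. \<psi>) b"
  have "\<phi> \<in> carrier ?H" using \<phi> by (simp add: carrier_subgroup_generated generate.incl)
  then have "\<phi> b \<in> ?O" by (auto simp: orbit_def)
  moreover have "b \<in> ?O" using b by (intro H.orbit_refl) simp
  moreover have "\<phi> b \<noteq> b" using fpf b by (auto simp: fixed_point_free_def)
  ultimately have "card ?O \<noteq> 1" by (auto simp: card_1_singleton_iff)
  moreover have "card ?O dvd A.ord \<phi>"
    using H.orbit_stabilizer_theorem[of b] b A.cyclic_order_is_ord[OF \<phi>] by (metis DiffD1 dvd_triv_left)
  ultimately show ?thesis using prime by (auto simp: prime_nat_iff)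
qed

text \<open>The group is named rather than existentially quantified, so that its order can later be
  compared with the rank \<open>card B\<close>.\<close>

lemma transitive_prime_order_Aut_group:
  assumes \<phi>: "\<phi> \<in> carrier (fusion_Aut R B)" and fpf: "fixed_point_free R B \<phi>"
    and prime: "prime (group.ord (fusion_Aut R B) \<phi>)"
    and two: "card (aut_orbits R B \<phi>) = 2" "{\<one>} \<in> aut_orbits R B \<phi>"
  shows "group basis_group"
    and "fusion_ring_iso R B (group_ring basis_group) (group_ring_basis basis_group)"
    and "basis_group \<cong> integer_mod_group 3 \<or>
      (\<exists>n::nat. n \<ge> 2 \<and> prime ((2::nat) ^ n - 1) \<and>
        basis_group \<cong> group_power (integer_mod_group 2) n)"
proof -
  interpret A: group "fusion_Aut R B" by (rule group_fusion_Aut)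
  let ?H = "subgroup_generated (fusion_Aut R B) {\<phi>}" and ?p = "A.ord \<phi>"
  interpret H: group_action ?H B "\<lambda>\<psi>. \<psi>" by (rule aut_group_action[OF \<phi>])
  obtain T where T: "orbits ?H B (\<lambda>\<psi>. \<psi>) = {{\<one>}, T}" "T \<noteq> {\<one>}"
    using two unfolding aut_orbits_def card_2_iff by fastforce
  then have "{\<one>} \<inter> T = {}" using H.disjoint_union[of "{\<one>}" T] by auto
  moreover have "{\<one>} \<union> T = B" using H.orbits_coverture T by simp
  ultimately have TB: "T = B - {\<one>}" by auto
  have orbit: "orbit ?H (\<lambda>\<psi>. \<psi>) b = B - {\<one>}" if b: "b \<in> B - {\<one>}" for b
  proof -
    have "orbit ?H (\<lambda>\<psi>. \<psi>) b \<in> {{\<one>}, T}" using b by (simp add: T(1)[symmetric] orbits_def) blast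
    moreover have "b \<in> orbit ?H (\<lambda>\<psi>. \<psi>) b" using b by (intro H.orbit_refl) simp
    ultimately show ?thesis using b TB by auto
  qed
  have aut_trans: "\<exists>f \<in> carrier (fusion_Aut R B). f a = b" if a: "a \<in> B - {\<one>}" and b: "b \<in> B - {\<one>}" for a b
  proof -
    have "b \<in> orbit ?H (\<lambda>\<psi>. \<psi>) a" using orbit[OF a] b by simp
    then show ?thesis using A.carrier_subgroup_generated_subset by (auto simp: orbit_def)
  qed
  have "T \<in> orbits ?H B (\<lambda>\<psi>. \<psi>)" by (simp add: T)
  then have "T \<noteq> {}" using H.orbit_refl by (fastforce simp: orbits_def)
  then obtain b where "b \<in> B - {\<one>}" using TB by auto
  then have card: "card (B - {\<one>}) = ?p" using card_aut_orbit[OF \<phi> fpf prime] orbit by metis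
  have p2: "?p \<ge> 2" using prime by (rule prime_ge_2_nat)
  note closed = transitive_Aut_basis_closed[OF aut_trans, unfolded card, OF _ _ p2]
  show grp: "group basis_group" by (rule group_basis_group[OF closed])
  show "fusion_ring_iso R B (group_ring basis_group) (group_ring_basis basis_group)"
    by (rule fusion_ring_iso_group_ring[OF closed])
  interpret G: group basis_group by (rule grp)
  have order: "order basis_group = ?p + 1"
    using card_Suc_Diff1[OF finite_basis one_in_basis] card by (simp add: order_def)
  show "basis_group \<cong> integer_mod_group 3 \<or> (\<exists>n::nat. n \<ge> 2 \<and> prime ((2::nat) ^ n - 1) \<and>
        basis_group \<cong> group_power (integer_mod_group 2) n)"
  proof (cases "?p = 2")
    case True
    then show ?thesis using G.prime_order_iso_integer_mod_group order by simp
  next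
    case False
    then have p3: "?p \<ge> 3" and "odd ?p" using p2 prime prime_odd_nat[of ?p] by auto
    then have "even (order basis_group)" by (simp add: order)
    then obtain x where x: "x \<in> B" "x \<noteq> \<one>" "x \<otimes> x = \<one>"
      using G.even_order_involution finite_basis by auto
    \<comment> \<open>Some automorphism carries the involution \<open>x\<close> to \<open>y\<close>,
      and it preserves products and the unit.\<close>
    have sq: "y \<otimes> y = \<one>" if y: "y \<in> B" for y
    proof (cases "y = \<one>")
      case False
      then obtain f where f: "f \<in> carrier (fusion_Aut R B)" "f x = y"
        using aut_trans[of x y] x y by auto
      then show ?thesis
        using Aut_mult[OF f(1) x(1) x(1)] x(3) Aut_lin_ext[OF f(1) one_in_basis] Aut_one[OF f(1)] by simp
    qed simp
    obtain n where n: "basis_group \<cong> group_power (integer_mod_group 2) n" "order basis_group = 2 ^ n"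
      using G.exponent_two_iso_group_power finite_basis sq by auto
    \<comment> \<open>The group has order \<open>?p + 1\<close>, so the prime \<open>?p\<close> is a
      Mersenne prime; \<open>?p \<ge> 3\<close> rules out \<open>n < 2\<close>.\<close>
    have pn: "2 ^ n - 1 = ?p" "(2::nat) ^ n \<ge> 4" using n(2) order p3 by auto
    have "n \<ge> 2"
    proof (rule ccontr)
      assume "\<not> n \<ge> 2"
      then have "n = 0 \<or> n = 1" by auto
      then show False using pn(2) by auto
    qed
    then show ?thesis using n(1) pn(1) prime by auto
  qed
qed

lemma two_aut_orbits_if_prime_nonunit_basis:
  assumes \<phi>: "\<phi> \<in> carrier (fusion_Aut R B)" and fpf: "fixed_point_free R B \<phi>"
    and prime: "prime (group.ord (fusion_Aut R B) \<phi>)"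
    and p: "card B = p + 1" "prime p"
  shows "card (aut_orbits R B \<phi>) = 2" "{\<one>} \<in> aut_orbits R B \<phi>"
proof -
  interpret A: group "fusion_Aut R B" by (rule group_fusion_Aut)
  let ?H = "subgroup_generated (fusion_Aut R B) {\<phi>}" and ?q = "A.ord \<phi>"
  interpret H: group_action ?H B "\<lambda>\<psi>. \<psi>" by (rule aut_group_action[OF \<phi>])
  let ?orb = "orbit ?H (\<lambda>\<psi>. \<psi>)"
  let ?Os = "orbits ?H B (\<lambda>\<psi>. \<psi>)"
  have "f \<one> = \<one>" if "f \<in> carrier ?H" for f
    using Aut_one that A.carrier_subgroup_generated_subset by blast
  then have orb1: "?orb \<one> = {\<one>}"
    using H.orbit_refl[OF one_in_basis] by (auto simp: orbit_def)
  then have one_orbit: "{\<one>} \<in> ?Os" using one_in_basis by (auto simp: orbits_def)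
  then show "{\<one>} \<in> aut_orbits R B \<phi>" by (simp add: aut_orbits_def)
  have cardB: "card (B - {\<one>}) = p" using p(1) finite_basis one_in_basis by simp
  have union: "\<Union>(?Os - {{\<one>}}) = B - {\<one>}"
    using H.orbits_coverture H.disjoint_union[OF one_orbit] by auto
  \<comment> \<open>The nontrivial orbits partition the \<open>p\<close> nonunit elements into
    blocks of size \<open>?q\<close>; both numbers are prime, hence equal, and one orbit fills
    \<open>B - {\<one>}\<close>.\<close>
  have "?q dvd card (\<Union>(?Os - {{\<one>}}))"
  proof (rule dvd_partition)
    show "finite (\<Union>(?Os - {{\<one>}}))" unfolding union by (simp add: finite_basis)
    show "\<forall>c\<in>?Os - {{\<one>}}. ?q dvd card c"
    proof
      fix c assume c: "c \<in> ?Os - {{\<one>}}"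
      then obtain b where "b \<in> B" "c = ?orb b" by (auto simp: orbits_def)
      moreover from this have "b \<noteq> \<one>" using c orb1 by auto
      ultimately show "?q dvd card c" using card_aut_orbit[OF \<phi> fpf prime, of b] by simp
    qed
    show "\<forall>c1\<in>?Os - {{\<one>}}. \<forall>c2\<in>?Os - {{\<one>}}. c1 \<noteq> c2 \<longrightarrow> c1 \<inter> c2 = {}"
      using H.disjoint_union by blast
  qed
  then have qp: "?q = p" using p(2) prime cardB union primes_dvd_imp_eq by auto
  have orb: "?orb b = B - {\<one>}" if b: "b \<in> B - {\<one>}" for b
  proof (rule card_subset_eq)
    have "?orb b \<in> ?Os - {{\<one>}}" using b H.orbit_refl[of b] by (auto simp: orbits_def)
    then show "?orb b \<subseteq> B - {\<one>}" using union by blast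
    show "card (?orb b) = card (B - {\<one>})" using card_aut_orbit[OF \<phi> fpf prime b] qp cardB by simp
  qed (simp add: finite_basis)
  have "B - {\<one>} \<noteq> {}" using cardB p(2) by (metis card.empty not_prime_0)
  then obtain b where b: "b \<in> B - {\<one>}" by blast
  have "?Os = {{\<one>}, B - {\<one>}}"
  proof
    show "?Os \<subseteq> {{\<one>}, B - {\<one>}}" using orb orb1 by (auto simp: orbits_def)
    show "{{\<one>}, B - {\<one>}} \<subseteq> ?Os" using one_orbit orb[OF b] b by (auto simp: orbits_def)
  qed
  then show "card (aut_orbits R B \<phi>) = 2" using b by (auto simp: aut_orbits_def card_2_iff)
qed

end

section \<open>The classification and the nonexistence statement\<close>

theorem mainTheorem4:
  shows "(\<forall>(R :: ('a, 'm) ring_scheme) B star \<phi>.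
            fusion_ring R B star \<and>
            \<phi> \<in> carrier (fusion_Aut R B) \<and>
            fixed_point_free R B \<phi> \<and>
            prime (group.ord (fusion_Aut R B) \<phi>) \<and>
            card (aut_orbits R B \<phi>) = 2 \<and> {\<one>\<^bsub>R\<^esub>} \<in> aut_orbits R B \<phi> \<longrightarrow>
            (\<exists>G :: 'a monoid. group G \<and> finite (carrier G) \<and>
               fusion_ring_iso R B (group_ring G) (group_ring_basis G) \<and>
               (G \<cong> integer_mod_group 3 \<or>
                (\<exists>n::nat. n \<ge> 2 \<and> prime ((2::nat) ^ n - 1) \<and>
                   G \<cong> group_power (integer_mod_group 2) n))))
       \<and> (\<forall>p::nat. prime p \<and> odd p \<and> p \<ge> 3 \<and> \<not> (\<exists>k::nat. p + 1 = 2 ^ k) \<longrightarrow>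
            \<not> (\<exists>(R :: ('a, 'm) ring_scheme) B star \<phi>.
                  fusion_ring R B star \<and> card B = p + 1 \<and>
                  \<phi> \<in> carrier (fusion_Aut R B) \<and>
                  fixed_point_free R B \<phi> \<and>
                  prime (group.ord (fusion_Aut R B) \<phi>)))"
proof (intro conjI allI impI)
  fix R :: "('a, 'm) ring_scheme" and B star \<phi>
  assume *: "fusion_ring R B star \<and> \<phi> \<in> carrier (fusion_Aut R B) \<and> fixed_point_free R B \<phi> \<and>
    prime (group.ord (fusion_Aut R B) \<phi>) \<and>
    card (aut_orbits R B \<phi>) = 2 \<and> {\<one>\<^bsub>R\<^esub>} \<in> aut_orbits R B \<phi>"
  then interpret fusion_ring R B star by simp
  have "finite (carrier basis_group)" by (simp add: finite_basis)
  then show "\<exists>G :: 'a monoid. group G \<and> finite (carrier G) \<and>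
      fusion_ring_iso R B (group_ring G) (group_ring_basis G) \<and>
      (G \<cong> integer_mod_group 3 \<or>
        (\<exists>n::nat. n \<ge> 2 \<and> prime ((2::nat) ^ n - 1) \<and> G \<cong> group_power (integer_mod_group 2) n))"
    using transitive_prime_order_Aut_group[of \<phi>] * by blast
next
  fix p :: nat
  assume p: "prime p \<and> odd p \<and> p \<ge> 3 \<and> \<not> (\<exists>k::nat. p + 1 = 2 ^ k)"
  show "\<not> (\<exists>(R :: ('a, 'm) ring_scheme) B star \<phi>. fusion_ring R B star \<and> card B = p + 1 \<and>
      \<phi> \<in> carrier (fusion_Aut R B) \<and> fixed_point_free R B \<phi> \<and>
      prime (group.ord (fusion_Aut R B) \<phi>))"
  proof (intro notI, elim exE conjE)
    fix R :: "('a, 'm) ring_scheme" and B star \<phi>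
    assume "fusion_ring R B star" and card: "card B = p + 1"
      and \<phi>: "\<phi> \<in> carrier (fusion_Aut R B)" "fixed_point_free R B \<phi>"
        "prime (group.ord (fusion_Aut R B) \<phi>)"
    then interpret fusion_ring R B star by simp
    have "prime p" using p by simp
    note two = two_aut_orbits_if_prime_nonunit_basis[OF \<phi> card this]
    \<comment> \<open>The rank \<open>p + 1\<close> would be 3, against \<open>p \<ge> 3\<close>, or
      a power of 2, which is excluded by assumption.\<close>
    show False
      using transitive_prime_order_Aut_group(3)[OF \<phi> two]
    proof (elim disjE exE conjE)
      assume "basis_group \<cong> integer_mod_group 3"
      from iso_same_card[OF this] show False using card p by (simp add: carrier_integer_mod_group)
    next
      fix n assume "basis_group \<cong> group_power (integer_mod_group 2) n"
      from iso_same_card[OF this] have "card B = 2 ^ n"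
        unfolding carrier_group_power_C2 by (simp add: card_PiE numeral_2_eq_2)
      then show False using card p by simp
    qed
  qed
qed

end
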